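(* Let $\tau=u+iv\in\mathbb H$ and $q=e^{2\pi i\tau}$. Define \[ g_1(q):=\sum_{n\ge1}\frac{q^n}{n(1+q^n)}, \] and \[ \widehat g_1(\tau):=2\log(2)-\gamma+\frac{6\zeta'(2)}{\pi^2}-\frac{\pi}{2}v+\frac{\log(v)}{2}+g_1(q)+g_1(\overline q), \] where $\gamma$ is the Euler–Mascheroni constant and $\zeta$ is the Riemann zeta function. Then \[ \widehat g_1(\tau)=-\frac{\pi}{6}\lim_{s\to1}\left(2E(2\tau;s)-E(\tau;s)-\frac{3}{\pi(s-1)}\right). \]
   Context: For $\operatorname{Re}(s)>1$, the Maass Eisenstein series is \[ E(\tau;s):=\sum_{\gamma\in\Gamma_\infty\backslash \mathrm{SL}_2(\mathbb Z)}\operatorname{Im}(\gamma\tau)^s, \] where $\Gamma_\infty=\{\pm\begin{pmatrix}1&n\\0&1\end{pmatrix}:n\in\mathbb Z\}$. For $s$ near $1$, $E(\tau;s)$ denotes its meromorphic continuation in $s$; it has a simple pole at $s=1$. *)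

theory Defs
  imports "HOL-Complex_Analysis.Complex_Analysis" "HOL-Algebra.Coset"
begin

unbundle no fps_syntax

definition SL2Z :: "(int^2^2) monoid" where
  "SL2Z = \<lparr>carrier = {A. det A = 1}, mult = (**), one = mat 1\<rparr>"

definition translation_matrix :: "int \<Rightarrow> int^2^2" where
  "translation_matrix n = vector [vector [1, n], vector [0, 1]]"

definition Gamma_inf :: "(int^2^2) set" where
  "Gamma_inf = range translation_matrix \<union> range (\<lambda>n. - translation_matrix n)"

definition moebius_action :: "int^2^2 \<Rightarrow> complex \<Rightarrow> complex" where
  "moebius_action A \<tau> =
     (of_int (A$1$1) * \<tau> + of_int (A$1$2)) / (of_int (A$2$1) * \<tau> + of_int (A$2$2))"

text \<open>
  HOL-Algebra's \<open>rcosets\<^bsub>G\<^esub> H\<close> is the set of all \<open>H g\<close>, that is, the quotient of \<open>G\<close> by \<open>H\<close> acting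
  on the left. For \<open>\<tau>\<close> in the upper half-plane, \<open>\<gamma> \<mapsto> Im (\<gamma>\<tau>)\<close> is constant on each coset of
  \<open>Gamma_inf\<close>, and \<open>the_elem\<close> picks out this common value. The definition is meaningful
  for \<open>Re s > 1\<close>, where the sum converges absolutely.
\<close>

definition eisenstein_series :: "complex \<Rightarrow> complex \<Rightarrow> complex" where
  "eisenstein_series \<tau> s =
     (\<Sum>\<^sub>\<infinity>C \<in> rcosets\<^bsub>SL2Z\<^esub> Gamma_inf.
        of_real (the_elem ((\<lambda>\<gamma>. Im (moebius_action \<gamma> \<tau>)) ` C)) powr s)"

text \<open>
  By the identity theorem, any two functions with the property below agree near \<open>1\<close>, so
  the choice operator is harmless there (and on \<open>Re s > 1\<close>). Elsewhere the value of
  \<open>eisenstein_E\<close> is unspecified.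
\<close>

definition is_continuation_near_1 :: "(complex \<Rightarrow> complex) \<Rightarrow> (complex \<Rightarrow> complex) \<Rightarrow> bool" where
  "is_continuation_near_1 f F \<longleftrightarrow>
     (\<forall>s. Re s > 1 \<longrightarrow> F s = f s) \<and>
     (\<exists>r>0. F nicely_meromorphic_on ({s. Re s > 1} \<union> ball 1 r))"

definition eisenstein_E :: "complex \<Rightarrow> complex \<Rightarrow> complex" where
  "eisenstein_E \<tau> = (SOME F. is_continuation_near_1 (eisenstein_series \<tau>) F)"

text \<open>The Riemann zeta function on \<open>Re s > 1\<close>, which is all that \<open>\<zeta>'(2)\<close> requires.\<close>

definition riemann_zeta :: "complex \<Rightarrow> complex" where
  "riemann_zeta s = (\<Sum>n. 1 / of_nat (Suc n) powr s)"

definition g1 :: "complex \<Rightarrow> complex" where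
  "g1 q = (\<Sum>n. q ^ Suc n / (of_nat (Suc n) * (1 + q ^ Suc n)))"

definition g1_hat :: "complex \<Rightarrow> complex" where
  "g1_hat \<tau> =
     (let v = Im \<tau>; q = exp (2 * of_real pi * \<i> * \<tau>) in
        2 * of_real (ln 2) - euler_mascheroni + 6 * deriv riemann_zeta 2 / of_real pi ^ 2
        - of_real (pi / 2 * v) + of_real (ln v / 2) + g1 q + g1 (cnj q))"

end

theory Submission
  imports Defs
begin

text \<open>
  This is Kronecker's first limit formula in disguise. Since \<open>\<zeta>(2s) E(\<tau>; s)\<close> is \<open>v\<^sup>s\<close> times the sum of
  \<open>|m\<tau> + n|\<^sup>-\<^sup>2\<^sup>s\<close> over half of the lattice, it suffices to continue the sum over \<open>m > 0\<close>. Replacing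
  each term by its difference to the integral of \<open>|m\<tau> + x|\<^sup>-\<^sup>2\<^sup>s\<close> over \<open>[n, n + 1]\<close> gains a factor
  \<open>|m\<tau> + n|\<^sup>-\<^sup>1\<close>, so the sum of the differences is holomorphic for \<open>Re s > 1/2\<close>; the integrals add up
  to \<open>v\<^sup>1\<^sup>-\<^sup>2\<^sup>s B(1/2, s - 1/2) \<zeta>(2s - 1)\<close>, which carries the pole. The same comparison of a sum with an
  integral isolates the pole of \<open>\<zeta>\<close> with constant term \<open>\<gamma>\<close>. At \<open>s = 1\<close> the differences are evaluated
  by the partial fraction expansion of the cotangent, which yields \<open>Re (q\<^sup>m / (1 - q\<^sup>m))\<close>, and the
  combination \<open>2E(2\<tau>; s) - E(\<tau>; s)\<close> produces \<open>g\<^sub>1\<close> through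
  \<open>x / (1 - x) - 2x\<^sup>2 / (1 - x\<^sup>2) = x / (1 + x)\<close>.
\<close>

subsection \<open>Cosets and primitive lattice points\<close>

text \<open>The sums are unordered, so splitting a double sum along rows requires summability of the
  whole beforehand. At s = 1 the lattice sum diverges, while every single row with m > 0 and its
  integral still converge; this is why the differences can be evaluated there row by row. To the
  left of Re s > 1 only a small ball around 1 is gained: dividing by zeta(2s) requires zeta(2s) to
  be nonzero, and there this is known from continuity at 2 alone. The residue 3/pi of the Eisenstein
  series at 1 does not depend on \<tau>, so the combination keeps the residue 2 * 3/pi - 3/pi, which
  the subtracted term cancels. In the final constant, -pi v/2 comes from the lattice points with m =
  0, gamma from zeta, \<open>g1\<close> from the differences at 1, and ln v, ln 2 and zeta'(2) all
  come from the derivative of the factor that multiplies the pole. Since \<open>eisenstein_E\<close>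
  is an arbitrary choice among continuations, the explicit formula has to be identified with it near
  1 before the limit is taken.\<close>

definition norm_form :: "complex \<Rightarrow> int \<Rightarrow> real \<Rightarrow> real" where
  "norm_form \<tau> m x = (cmod (of_int m * \<tau> + of_real x))\<^sup>2"

text \<open>One representative of each pair of opposite nonzero lattice points, because
  \<open>Gamma_inf\<close> contains -1 and a coset knows its bottom row only up to sign. This choice
  keeps complete rows over all integers n for m > 0, so that row sums can be compared with integrals
  over the whole line.\<close>

definition half_lattice :: "(int \<times> int) set" where
  "half_lattice = {(m, n). m > 0 \<or> m = 0 \<and> n > 0}"

definition primitive_pairs :: "(int \<times> int) set" where
  "primitive_pairs = {(c, d) \<in> half_lattice. coprime c d}"

definition bottom_row_coset :: "int \<times> int \<Rightarrow> (int^2^2) set" where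
  "bottom_row_coset = (\<lambda>(c, d). {A. det A = 1 \<and>
     (A$2$1 = c \<and> A$2$2 = d \<or> A$2$1 = - c \<and> A$2$2 = - d)})"

lemma norm_form_altdef: "norm_form \<tau> m x = (x + of_int m * Re \<tau>)\<^sup>2 + (of_int m * Im \<tau>)\<^sup>2"
  by (simp add: norm_form_def cmod_power2 add_ac)

lemma norm_form_pos:
  assumes "Im \<tau> > 0" and "m \<noteq> 0 \<or> x \<noteq> 0"
  shows   "norm_form \<tau> m x > 0"
proof -
  have "of_int m * \<tau> + of_real x \<noteq> 0"
    using assms by (auto simp: complex_eq_iff)
  thus ?thesis by (simp add: norm_form_def)
qed

lemma Im_moebius_action:
  fixes A :: "int^2^2"
  assumes "det A = 1"
  shows   "Im (moebius_action A \<tau>) = Im \<tau> / norm_form \<tau> (A$2$1) (of_int (A$2$2))"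
proof -
  define a b c d where defs: "a = A$1$1" "b = A$1$2" "c = A$2$1" "d = A$2$2"
  have "of_int (a * d - b * c) = (1 :: real)"
    using assms by (simp add: det_2 defs)
  hence "real_of_int a * of_int d = 1 + of_int b * of_int c" by simp
  moreover have "Im (moebius_action A \<tau>) =
      (of_int a * of_int d - of_int b * of_int c) * Im \<tau> / norm_form \<tau> c (of_int d)"
    unfolding moebius_action_def norm_form_altdef defs[symmetric]
    by (simp add: Im_divide) (simp add: algebra_simps)
  ultimately show ?thesis by (simp add: defs)
qed

lemma norm_form_minus: "norm_form \<tau> (- m) (- x) = norm_form \<tau> m x"
  by (simp add: norm_form_def norm_minus_commute flip: norm_minus_cancel[of "of_int m * \<tau> + of_real x"])

lemma Gamma_inf_iff:
  "h \<in> Gamma_inf \<longleftrightarrow> (\<exists>n. h = translation_matrix n \<or> h = - translation_matrix n)"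
  unfolding Gamma_inf_def by auto

text \<open>Multiplying by a translation on the left adds a multiple of the bottom row to the top
  row and changes nothing else. Conversely, determinant one forces two matrices with equal bottom
  rows to differ in this way.\<close>

lemma coset_Gamma_inf:
  fixes A :: "int^2^2"
  assumes "det A = 1"
  shows   "Gamma_inf #>\<^bsub>SL2Z\<^esub> A = bottom_row_coset (A$2$1, A$2$2)"
proof (rule Set.set_eqI)
  fix B :: "int^2^2"
  define a b c d where defs: "a = A$1$1" "b = A$1$2" "c = A$2$1" "d = A$2$2"
  define a' b' c' d' where defs': "a' = B$1$1" "b' = B$1$2" "c' = B$2$1" "d' = B$2$2"
  have det: "a * d - b * c = 1" using assms by (simp add: det_2 defs)
  have T: "B = translation_matrix n ** A \<longleftrightarrow> a' = a + n * c \<and> b' = b + n * d \<and> c' = c \<and> d' = d"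
    "B = - translation_matrix n ** A \<longleftrightarrow>
       a' = - (a + n * c) \<and> b' = - (b + n * d) \<and> c' = - c \<and> d' = - d" for n
    by (auto simp: vec_eq_iff forall_2 matrix_matrix_mult_def sum_2 translation_matrix_def defs defs')
  have "B \<in> Gamma_inf #>\<^bsub>SL2Z\<^esub> A \<longleftrightarrow>
          (\<exists>n. B = translation_matrix n ** A \<or> B = - translation_matrix n ** A)"
    unfolding r_coset_def SL2Z_def by (simp add: Bex_def Gamma_inf_iff) blast
  also have "\<dots> \<longleftrightarrow> a' * d' - b' * c' = 1 \<and> (c' = c \<and> d' = d \<or> c' = - c \<and> d' = - d)"
  proof (intro iffI; elim exE conjE disjE)
    fix n assume "B = translation_matrix n ** A"
    note * = this[unfolded T]
    have "a' * d' - b' * c' = a * d - b * c" by (simp add: * algebra_simps)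
    thus "a' * d' - b' * c' = 1 \<and> (c' = c \<and> d' = d \<or> c' = - c \<and> d' = - d)"
      using * det by simp
  next
    fix n assume "B = - translation_matrix n ** A"
    note * = this[unfolded T]
    have "a' * d' - b' * c' = a * d - b * c" by (simp add: * algebra_simps)
    thus "a' * d' - b' * c' = 1 \<and> (c' = c \<and> d' = d \<or> c' = - c \<and> d' = - d)"
      using * det by simp
  next
    assume *: "a' * d' - b' * c' = 1" "c' = c" "d' = d"
    \<comment> \<open>The translation length is the upper right entry of B times the inverse of A;
      in the other case below it is that entry for -B.\<close>
    have "a' = a + (a * b' - a' * b) * c" "b' = b + (a * b' - a' * b) * d"
      using det * by algebra+
    thus "\<exists>n. B = translation_matrix n ** A \<or> B = - translation_matrix n ** A"
      unfolding T using * by blast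
  next
    assume *: "a' * d' - b' * c' = 1" "c' = - c" "d' = - d"
    have "a' = - (a + (a' * b - a * b') * c)" "b' = - (b + (a' * b - a * b') * d)"
      using det * by algebra+
    thus "\<exists>n. B = translation_matrix n ** A \<or> B = - translation_matrix n ** A"
      unfolding T using * by blast
  qed
  finally show "B \<in> Gamma_inf #>\<^bsub>SL2Z\<^esub> A \<longleftrightarrow> B \<in> bottom_row_coset (A$2$1, A$2$2)"
    by (simp add: bottom_row_coset_def det_2 defs defs')
qed

lemma det_1_with_bottom_row:
  assumes "coprime c d"
  obtains A :: "int^2^2" where "det A = 1" "A$2$1 = c" "A$2$2 = d"
proof -
  obtain u v where "u * c + v * d = gcd c d" using bezout_int by blast
  with assms have "det (vector [vector [v, - u], vector [c, d]] :: int^2^2) = 1"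
    by (simp add: det_2)
  thus ?thesis using that by fastforce
qed

lemma coprime_bottom_row:
  fixes A :: "int^2^2"
  assumes "det A = 1"
  shows   "coprime (A$2$1) (A$2$2)"
proof (rule coprimeI)
  fix k assume "k dvd A$2$1" "k dvd A$2$2"
  hence "k dvd A$1$1 * A$2$2 - A$1$2 * A$2$1" by (intro dvd_diff dvd_mult)
  thus "is_unit k" using assms by (simp add: det_2)
qed

text \<open>A coset is its bottom row up to sign, and exactly one of the two signs lies in
  \<open>half_lattice\<close>. Bezout's identity provides a matrix for each coprime row, and
  determinant one makes each bottom row coprime.\<close>

lemma bij_betw_cosets: "bij_betw bottom_row_coset primitive_pairs (rcosets\<^bsub>SL2Z\<^esub> Gamma_inf)"
  unfolding bij_betw_def
proof
  show "inj_on bottom_row_coset primitive_pairs"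
  proof (rule inj_onI, safe)
    fix c d c' d'
    assume *: "(c, d) \<in> primitive_pairs" "(c', d') \<in> primitive_pairs"
              "bottom_row_coset (c, d) = bottom_row_coset (c', d')"
    obtain A :: "int^2^2" where A: "det A = 1" "A$2$1 = c" "A$2$2 = d"
      using *(1) det_1_with_bottom_row[of c d] by (auto simp: primitive_pairs_def)
    hence "A \<in> bottom_row_coset (c', d')" unfolding *(3)[symmetric] by (simp add: bottom_row_coset_def)
    thus "c = c'" "d = d'" using A *(1,2)
      by (auto simp: bottom_row_coset_def primitive_pairs_def half_lattice_def)
  qed
  show "bottom_row_coset ` primitive_pairs = rcosets\<^bsub>SL2Z\<^esub> Gamma_inf"
  proof (intro equalityI subsetI)
    fix C assume "C \<in> bottom_row_coset ` primitive_pairs"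
    then obtain c d where C: "C = bottom_row_coset (c, d)" "coprime c d"
      by (auto simp: primitive_pairs_def)
    obtain A :: "int^2^2" where A: "det A = 1" "A$2$1 = c" "A$2$2 = d"
      using C(2) det_1_with_bottom_row by blast
    have "C = Gamma_inf #>\<^bsub>SL2Z\<^esub> A" using coset_Gamma_inf[OF A(1)] A C by simp
    thus "C \<in> rcosets\<^bsub>SL2Z\<^esub> Gamma_inf" using A by (auto simp: RCOSETS_def SL2Z_def)
  next
    fix C assume "C \<in> rcosets\<^bsub>SL2Z\<^esub> Gamma_inf"
    then obtain A where A: "det A = 1" "C = Gamma_inf #>\<^bsub>SL2Z\<^esub> A"
      by (auto simp: RCOSETS_def SL2Z_def)
    define c d where "c = A$2$1" "d = A$2$2"
    have C: "C = bottom_row_coset (c, d)" using coset_Gamma_inf A by (simp add: c_d_def)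
    have C': "C = bottom_row_coset (- c, - d)" using C by (auto simp: bottom_row_coset_def)
    have cop: "coprime c d" using coprime_bottom_row[OF A(1)] by (simp add: c_d_def)
    hence "c \<noteq> 0 \<or> d \<noteq> 0" by auto
    hence "(c, d) \<in> primitive_pairs \<or> (- c, - d) \<in> primitive_pairs"
      using cop by (auto simp: primitive_pairs_def half_lattice_def)
    thus "C \<in> bottom_row_coset ` primitive_pairs" using C C' by blast
  qed
qed

lemma the_elem_bottom_row_coset:
  assumes "(c, d) \<in> primitive_pairs"
  shows   "the_elem ((\<lambda>\<gamma>. Im (moebius_action \<gamma> \<tau>)) ` bottom_row_coset (c, d)) =
             Im \<tau> / norm_form \<tau> c (of_int d)"
proof -
  obtain A :: "int^2^2" where A: "det A = 1" "A$2$1 = c" "A$2$2 = d"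
    using assms det_1_with_bottom_row[of c d] by (auto simp: primitive_pairs_def)
  have "(\<lambda>\<gamma>. Im (moebius_action \<gamma> \<tau>)) ` bottom_row_coset (c, d) = {Im \<tau> / norm_form \<tau> c (of_int d)}"
  proof (intro equalityI subsetI)
    fix x assume "x \<in> (\<lambda>\<gamma>. Im (moebius_action \<gamma> \<tau>)) ` bottom_row_coset (c, d)"
    then obtain B :: "int^2^2" where B: "det B = 1" "B$2$1 = c \<and> B$2$2 = d \<or> B$2$1 = - c \<and> B$2$2 = - d"
      and x: "x = Im (moebius_action B \<tau>)"
      by (auto simp: bottom_row_coset_def)
    show "x \<in> {Im \<tau> / norm_form \<tau> c (of_int d)}"
      using B norm_form_minus[of \<tau> c "of_int d"] by (auto simp: x Im_moebius_action)
  next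
    fix x assume "x \<in> {Im \<tau> / norm_form \<tau> c (of_int d)}"
    thus "x \<in> (\<lambda>\<gamma>. Im (moebius_action \<gamma> \<tau>)) ` bottom_row_coset (c, d)"
      using A by (intro image_eqI[of _ _ A]) (auto simp: Im_moebius_action bottom_row_coset_def)
  qed
  thus ?thesis by simp
qed

lemma eisenstein_series_altdef:
  "eisenstein_series \<tau> s =
     (\<Sum>\<^sub>\<infinity>(c, d)\<in>primitive_pairs. of_real (Im \<tau> / norm_form \<tau> c (of_int d)) powr s)"
  unfolding eisenstein_series_def
  by (subst infsum_reindex_bij_betw[OF bij_betw_cosets, symmetric], rule infsum_cong)
     (auto simp: the_elem_bottom_row_coset)

text \<open>Each point is its gcd times a primitive point. Summing over the gcd is what produces the
  factor zeta(2s) in front of the Eisenstein series.\<close>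

lemma bij_betw_half_lattice:
  "bij_betw (\<lambda>(k, c, d). (k * c, k * d)) ({0<..} \<times> primitive_pairs) half_lattice"
proof (rule bij_betwI')
  fix x y :: "int \<times> int \<times> int"
  assume "x \<in> {0<..} \<times> primitive_pairs" "y \<in> {0<..} \<times> primitive_pairs"
  then obtain k c d k' c' d' where *: "x = (k, c, d)" "y = (k', c', d')" "k > 0" "k' > 0"
     "coprime c d" "coprime c' d'"
    by (auto simp: primitive_pairs_def)
  have "k = k'" if "k * c = k' * c'" "k * d = k' * d'"
  proof -
    have "gcd (k * c) (k * d) = k" "gcd (k' * c') (k' * d') = k'"
      using * by (simp_all add: gcd_mult_left)
    thus ?thesis using that by simp
  qed
  thus "((case x of (k, c, d) \<Rightarrow> (k * c, k * d)) = (case y of (k, c, d) \<Rightarrow> (k * c, k * d))) = (x = y)"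
    using * by auto
next
  fix x :: "int \<times> int \<times> int" assume "x \<in> {0<..} \<times> primitive_pairs"
  thus "(case x of (k, c, d) \<Rightarrow> (k * c, k * d)) \<in> half_lattice"
    by (auto simp: primitive_pairs_def half_lattice_def zero_less_mult_iff)
next
  fix y assume y: "y \<in> half_lattice"
  obtain m n where [simp]: "y = (m, n)" by (cases y)
  define k where "k = gcd m n"
  have k: "k > 0" using y by (auto simp: half_lattice_def k_def)
  obtain c d where cd: "m = k * c" "n = k * d" "coprime c d"
    using gcd_coprime_exists[of m n] k unfolding k_def[symmetric]
    by (metis less_irrefl mult.commute)
  have "(c, d) \<in> primitive_pairs" using y k cd
    by (auto simp: primitive_pairs_def half_lattice_def zero_less_mult_iff)
  thus "\<exists>x\<in>{0<..} \<times> primitive_pairs. y = (case x of (k, c, d) \<Rightarrow> (k * c, k * d))"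
    using k cd by (intro bexI[of _ "(k, c, d)"]) auto
qed

subsection \<open>Holomorphic sums and integrals of complex powers\<close>

lemma of_real_powr_eq_exp: "y > 0 \<Longrightarrow> (of_real y :: complex) powr s = exp (s * of_real (ln y))"
  by (simp add: powr_def Ln_of_real)

lemma norm_of_real_powr: "y \<ge> 0 \<Longrightarrow> norm (of_real y powr s :: complex) = y powr Re s"
  by (simp add: norm_powr_real_powr)

text \<open>Weierstrass M-test on a small disc around each point: the finite partial sums converge
  uniformly there, so the limit is holomorphic. No enumeration of the index set enters, which suits
  sums over pairs of integers.\<close>

lemma holomorphic_on_infsum:
  fixes f :: "'a \<Rightarrow> complex \<Rightarrow> complex"
  assumes "open S" and holo: "\<And>x. x \<in> X \<Longrightarrow> f x holomorphic_on S"
  assumes bound: "\<And>z. z \<in> S \<Longrightarrow> \<exists>r M. r > 0 \<and> cball z r \<subseteq> S \<and> M summable_on X \<and>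
                    (\<forall>x\<in>X. \<forall>w\<in>cball z r. norm (f x w) \<le> M x)"
  shows   "(\<lambda>z. \<Sum>\<^sub>\<infinity>x\<in>X. f x z) holomorphic_on S"
proof -
  have "(\<lambda>z. \<Sum>\<^sub>\<infinity>x\<in>X. f x z) field_differentiable (at z)" if z: "z \<in> S" for z
  proof -
    obtain r M where r: "r > 0" "cball z r \<subseteq> S" and M: "M summable_on X"
      "\<And>x w. x \<in> X \<Longrightarrow> w \<in> cball z r \<Longrightarrow> norm (f x w) \<le> M x"
      using bound[OF z] by blast
    have holo': "(\<lambda>w. \<Sum>x\<in>Y. f x w) holomorphic_on S" if "Y \<subseteq> X" for Y
      using holo that by (intro holomorphic_on_sum) auto
    have "(\<lambda>z. \<Sum>\<^sub>\<infinity>x\<in>X. f x z) holomorphic_on ball z r"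
    proof (rule holomorphic_uniform_limit[OF _ Weierstrass_m_test_general])
      show "\<forall>\<^sub>F Y in finite_subsets_at_top X. continuous_on (cball z r) (\<lambda>w. \<Sum>x\<in>Y. f x w) \<and>
              (\<lambda>w. \<Sum>x\<in>Y. f x w) holomorphic_on ball z r"
      proof (intro eventually_finite_subsets_at_top_weakI conjI)
        fix Y assume "finite Y" "Y \<subseteq> X"
        from holo'[OF this(2)] r(2) have "(\<lambda>w. \<Sum>x\<in>Y. f x w) holomorphic_on cball z r"
          by (rule holomorphic_on_subset)
        thus "continuous_on (cball z r) (\<lambda>w. \<Sum>x\<in>Y. f x w)"
             "(\<lambda>w. \<Sum>x\<in>Y. f x w) holomorphic_on ball z r"
          using ball_subset_cball holomorphic_on_subset
          by (blast intro: holomorphic_on_imp_continuous_on)+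
      qed
    qed (use M r in auto)
    thus ?thesis using r(1) by (simp add: holomorphic_on_open field_differentiable_def)
  qed
  thus ?thesis by (simp add: holomorphic_on_def field_differentiable_at_within)
qed

lemma has_field_derivative_of_real_powr:
  fixes s :: complex
  assumes "p > 0"
  shows   "((\<lambda>s. of_real p powr (- s)) has_field_derivative
             - of_real (ln p) * of_real p powr (- s)) (at s within A)"
  using assms by (auto simp: of_real_powr_eq_exp intro!: derivative_eq_intros)

lemma continuous_on_of_real_powr:
  assumes "continuous_on A p" "\<And>x. x \<in> A \<Longrightarrow> p x > 0"
  shows   "continuous_on A (\<lambda>x. of_real (p x) powr s :: complex)"
proof -
  have "continuous_on A (\<lambda>x. exp (s * of_real (ln (p x))) :: complex)"
    using assms by (intro continuous_intros) force+
  thus ?thesis using assms(2) by (simp add: of_real_powr_eq_exp cong: continuous_on_cong)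
qed

text \<open>Differentiation under the integral sign; positivity of p on a compact interval makes the
  s-derivative of the integrand jointly continuous.\<close>

lemma holomorphic_on_integral_powr:
  fixes p :: "real \<Rightarrow> real"
  assumes "continuous_on {a..b} p" "\<And>x. x \<in> {a..b} \<Longrightarrow> p x > 0"
  shows   "(\<lambda>s. integral {a..b} (\<lambda>x. of_real (p x) powr (- s))) holomorphic_on S"
proof -
  have "(\<lambda>s. integral (cbox a b) (\<lambda>x. of_real (p x) powr (- s))) holomorphic_on UNIV"
  proof (rule leibniz_rule_holomorphic)
    show "((\<lambda>s. of_real (p t) powr (- s)) has_field_derivative
            - of_real (ln (p t)) * exp (- s * of_real (ln (p t)))) (at s within UNIV)"
      if "t \<in> cbox a b" for s :: complex and t
      using has_field_derivative_of_real_powr[of "p t" s UNIV] that assms(2)[of t]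
      by (simp add: of_real_powr_eq_exp)
    show "(\<lambda>x. of_real (p x) powr (- s) :: complex) integrable_on cbox a b" for s
      unfolding cbox_interval
      by (intro integrable_continuous_interval continuous_on_of_real_powr assms)
    have [continuous_intros]: "continuous_on (UNIV \<times> cbox a b) (\<lambda>x :: complex \<times> real. p (snd x))"
      by (rule continuous_on_compose2[OF assms(1)]) (auto intro!: continuous_intros)
    have "snd x \<in> cbox a b \<Longrightarrow> p (snd x) \<noteq> 0" for x :: "complex \<times> real"
      using assms(2)[of "snd x"] by auto
    thus "continuous_on (UNIV \<times> cbox a b)
            (\<lambda>(s :: complex, t). - of_real (ln (p t)) * exp (- s * of_real (ln (p t))))"
      unfolding case_prod_unfold by (intro continuous_intros) auto
  qed auto
  thus ?thesis by (metis cbox_interval holomorphic_on_subset subset_UNIV)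
qed

section \<open>Comparison of a term with the integral over the following unit interval\<close>

definition powr_gap :: "(real \<Rightarrow> real) \<Rightarrow> real \<Rightarrow> complex \<Rightarrow> complex" where
  "powr_gap p a s = of_real (p a) powr (- s) - integral {a..a+1} (\<lambda>x. of_real (p x) powr (- s))"

lemma holomorphic_on_powr_gap:
  assumes "continuous_on {a..a+1} p" "\<And>x. x \<in> {a..a+1} \<Longrightarrow> p x > 0"
  shows   "powr_gap p a holomorphic_on S"
proof -
  have "(\<lambda>s. of_real (p a) powr (- s)) holomorphic_on S"
    by (intro holomorphic_intros)
  thus ?thesis unfolding powr_gap_def [abs_def]
    by (intro holomorphic_on_diff holomorphic_on_integral_powr assms) auto
qed

text \<open>Mean value estimate: the derivative of p^(-s) is -s p' p^(-s-1), so on an interval of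
  length one the function strays from its left end value by at most |s| K. The function p stays
  general because two cases are used: p x = x for zeta, where a full power is gained, and the
  quadratic norm form, where |p'| is at most twice the square root of p and half a power of p is
  gained.\<close>

lemma norm_powr_gap_le:
  assumes deriv: "\<And>x. x \<in> {a..a+1} \<Longrightarrow> (p has_real_derivative p' x) (at x within {a..a+1})"
  assumes pos: "\<And>x. x \<in> {a..a+1} \<Longrightarrow> p x > 0"
  assumes K: "\<And>x. x \<in> {a..a+1} \<Longrightarrow> \<bar>p' x\<bar> * p x powr (- Re s - 1) \<le> K"
  shows   "norm (powr_gap p a s) \<le> norm s * K"
proof -
  define f where "f = (\<lambda>x. of_real (p x) powr (- s) :: complex)"
  have cont: "continuous_on {a..a+1} p"
    using deriv by (rule DERIV_continuous_on)
  have integrable: "f integrable_on {a..a+1}"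
    unfolding f_def by (intro integrable_continuous_interval continuous_on_of_real_powr cont pos)
  have f': "(f has_vector_derivative (- s * of_real (p' x) * of_real (p x) powr (- s - 1)))
              (at x within {a..a+1})" if x: "x \<in> {a..a+1}" for x
  proof -
    have "((\<lambda>x. ln (p x)) has_real_derivative (p' x / p x)) (at x within {a..a+1})"
      using pos[OF x] deriv[OF x] by (auto intro!: derivative_eq_intros)
    hence "((\<lambda>x. of_real (ln (p x)) :: complex) has_vector_derivative of_real (p' x / p x))
             (at x within {a..a+1})"
      by (intro has_vector_derivative_of_real)
    moreover have "((\<lambda>z. exp (- s * z)) has_field_derivative - s * exp (- s * z)) (at z within A)" for z A
      by (auto intro!: derivative_eq_intros)
    ultimately have "((\<lambda>z. exp (- s * z)) \<circ> (\<lambda>x. of_real (ln (p x))) has_vector_derivative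
             of_real (p' x / p x) * (- s * exp (- s * of_real (ln (p x))))) (at x within {a..a+1})"
      by (rule field_vector_diff_chain_within)
    hence "((\<lambda>x. exp (- s * of_real (ln (p x)))) has_vector_derivative
             (- s * of_real (p' x / p x)) * exp (- s * of_real (ln (p x)))) (at x within {a..a+1})"
      by (simp add: o_def mult_ac)
    also have "(- s * of_real (p' x / p x)) * exp (- s * of_real (ln (p x))) =
                 - s * of_real (p' x) * of_real (p x) powr (- s - 1)"
      using pos[OF x] by (simp add: of_real_powr_eq_exp left_diff_distrib exp_diff exp_of_real)
    finally show ?thesis
      by (rule has_vector_derivative_transform[rotated 2])
         (use x pos in \<open>auto simp: f_def of_real_powr_eq_exp\<close>)
  qed
  have "norm (f x - f a) \<le> norm s * K" if x: "x \<in> {a..a+1}" for x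
  proof -
    have "norm (f x - f a) \<le> norm s * K * norm (x - a)"
    proof (rule differentiable_bound)
      show "(f has_derivative (\<lambda>h. h *\<^sub>R (- s * of_real (p' y) * of_real (p y) powr (- s - 1))))
              (at y within {a..a+1})" if "y \<in> {a..a+1}" for y
        using f'[OF that] by (simp add: has_vector_derivative_def)
      show "onorm (\<lambda>h. h *\<^sub>R (- s * of_real (p' y) * of_real (p y) powr (- s - 1))) \<le> norm s * K"
        if y: "y \<in> {a..a+1}" for y
      proof (rule onorm_le)
        fix h :: real
        have "norm (- s * of_real (p' y) * of_real (p y) powr (- s - 1)) =
                norm s * (\<bar>p' y\<bar> * p y powr (- Re s - 1))"
          using pos[OF y] by (simp add: norm_mult norm_of_real_powr)
        also have "\<dots> \<le> norm s * K" using K[OF y] by (intro mult_left_mono) auto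
        finally show "norm (h *\<^sub>R (- s * of_real (p' y) * of_real (p y) powr (- s - 1))) \<le>
                        norm s * K * norm h"
          by (subst norm_scaleR) (simp add: mult.commute mult_left_mono)
      qed
    qed (use x in auto)
    also have "\<dots> \<le> norm s * K * 1"
      using x order.trans[OF _ K[OF x]] by (intro mult_left_mono) auto
    finally show ?thesis by simp
  qed
  hence *: "norm (integral {a..a+1} (\<lambda>x. f x - f a)) \<le> norm s * K * (a + 1 - a)"
    by (intro integral_bound) (auto intro!: integrable_continuous_interval continuous_intros
          continuous_on_of_real_powr cont pos simp: f_def)
  have "powr_gap p a s = f a - integral {a..a+1} f"
    by (simp add: powr_gap_def f_def)
  \<comment> \<open>The interval has length one, so the constant \<open>f a\<close> is its own
    integral.\<close>
  also have "\<dots> = - integral {a..a+1} (\<lambda>x. f x - f a)"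
    using integrable by (subst integral_diff) (auto simp: algebra_simps)
  finally show ?thesis using * by simp
qed

lemma has_sum_diff:
  fixes f g :: "'a \<Rightarrow> 'b :: real_normed_algebra_1"
  assumes "(f has_sum a) A" "(g has_sum b) A"
  shows   "((\<lambda>x. f x - g x) has_sum (a - b)) A"
  using has_sum_add[OF assms(1) has_sum_uminusI[OF assms(2)]] by simp

subsection \<open>The Riemann zeta function near its pole\<close>

lemma bij_betw_Suc_pos_int: "bij_betw (\<lambda>n. int (Suc n)) UNIV {0<..}"
  by (rule bij_betwI[where g = "\<lambda>k. nat (k - 1)"]) auto

lemma has_sum_pos_int_iff:
  "(f has_sum S) {0<..} \<longleftrightarrow> ((\<lambda>n. f (int (Suc n))) has_sum S) UNIV"
  using has_sum_reindex_bij_betw[OF bij_betw_Suc_pos_int, of f S] by simp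

lemma summable_on_powr_pos_int:
  assumes "p > 1"
  shows   "(\<lambda>k::int. of_int k powr (- p) :: real) summable_on {0<..}"
proof -
  have "summable (\<lambda>n. of_nat n powr (- p) :: real)"
    using assms by (simp add: summable_real_powr_iff)
  hence "summable (\<lambda>n. of_nat (Suc n) powr (- p) :: real)"
    by (subst summable_Suc_iff)
  hence "(\<lambda>n. real (Suc n) powr (- p)) summable_on UNIV"
    by (intro norm_summable_imp_summable_on) simp
  thus ?thesis
    using summable_on_reindex_bij_betw[OF bij_betw_Suc_pos_int, of "\<lambda>k. of_int k powr (- p) :: real"]
    by simp
qed

lemma has_sum_riemann_zeta:
  assumes "Re s > 1"
  shows   "((\<lambda>k::int. of_real (of_int k) powr (- s)) has_sum riemann_zeta s) {0<..}"
proof -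
  have "(\<lambda>k::int. norm (of_real (of_int k) powr (- s) :: complex)) summable_on {0<..}"
    using summable_on_powr_pos_int[OF assms]
    by (rule summable_on_cong[THEN iffD1, rotated]) (simp add: norm_of_real_powr del: of_real_of_int_eq)
  hence "(\<lambda>k::int. of_real (of_int k) powr (- s) :: complex) summable_on {0<..}"
    by (rule abs_summable_summable)
  then obtain S where S: "((\<lambda>k::int. of_real (of_int k) powr (- s)) has_sum S) {0<..}"
    by (auto simp: summable_on_def)
  hence "(\<lambda>n. of_nat (Suc n) powr (- s)) sums S"
    by (intro has_sum_imp_sums) (simp add: has_sum_pos_int_iff)
  hence "S = riemann_zeta s"
    unfolding riemann_zeta_def by (simp add: sums_iff powr_minus_divide)
  with S show ?thesis by simp
qed

text \<open>On \<open>Re s \<ge> 2\<close> no Euler product is needed: \<open>|\<zeta>(s) - 1| \<le> \<zeta>(2) - 1 < 1\<close>.\<close>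

lemma riemann_zeta_ne_0:
  assumes "Re s \<ge> 2"
  shows   "riemann_zeta s \<noteq> 0"
proof
  assume "riemann_zeta s = 0"
  have *: "summable (\<lambda>n. norm (of_nat (Suc n) powr (- s)))" "(\<lambda>n. of_nat (Suc n) powr (- s)) sums riemann_zeta s"
  proof -
    have "summable (\<lambda>n. of_nat n powr (- Re s) :: real)"
      using assms by (simp add: summable_real_powr_iff)
    hence "summable (\<lambda>n. of_nat (Suc n) powr (- Re s) :: real)"
      by (subst summable_Suc_iff)
    moreover have "norm (of_nat (Suc n) powr (- s)) = of_nat (Suc n) powr (- Re s)" for n
      using norm_of_real_powr[of "real (Suc n)" "-s"] by simp
    ultimately show "summable (\<lambda>n. norm (of_nat (Suc n) powr (- s)))" by simp
    show "(\<lambda>n. of_nat (Suc n) powr (- s)) sums riemann_zeta s"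
      using has_sum_riemann_zeta[of s] assms
      by (intro has_sum_imp_sums) (simp add: has_sum_pos_int_iff)
  qed
  have "(\<lambda>n. of_nat (Suc (Suc n)) powr (- s)) sums (riemann_zeta s - 1)"
    using *(2) by (subst sums_Suc_iff) simp
  hence le1: "norm (riemann_zeta s - 1) \<le> (\<Sum>n. norm (of_nat (Suc (Suc n)) powr (- s)))"
    using summable_norm[of "\<lambda>n. of_nat (Suc (Suc n)) powr (- s)"] *(1)[THEN summable_Suc_iff[THEN iffD2]]
    by (simp only: sums_iff)
  have squares: "(\<lambda>n. 1 / (real (Suc n) + 1)\<^sup>2) sums (pi\<^sup>2 / 6 - 1)"
  proof -
    have "(\<lambda>n. 1 / (real n + 1)\<^sup>2) sums (pi\<^sup>2 / 6)"
      using inverse_squares_sums by (simp add: add_ac)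
    thus ?thesis by (subst sums_Suc_iff) simp
  qed
  have "(\<Sum>n. norm (of_nat (Suc (Suc n)) powr (- s))) \<le> (\<Sum>n. 1 / (real (Suc n) + 1)\<^sup>2)"
  proof (rule suminf_le)
    fix n
    have "norm (of_nat (Suc (Suc n)) powr (- s)) = real (Suc (Suc n)) powr (- Re s)"
      using norm_of_real_powr[of "real (Suc (Suc n))" "-s"] by simp
    also have "\<dots> \<le> real (Suc (Suc n)) powr (- 2)"
      using assms by (intro powr_mono) auto
    also have "\<dots> = 1 / (real (Suc n) + 1)\<^sup>2"
      by (simp add: powr_minus_divide powr_numeral add_ac)
    finally show "norm (of_nat (Suc (Suc n)) powr (- s)) \<le> 1 / (real (Suc n) + 1)\<^sup>2" .
  next
    show "summable (\<lambda>n. norm (of_nat (Suc (Suc n)) powr (- s)))"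
      by (rule *(1)[THEN summable_Suc_iff[THEN iffD2]])
    show "summable (\<lambda>n. 1 / (real (Suc n) + 1)\<^sup>2)"
      using squares by (rule sums_summable)
  qed
  also have "\<dots> = pi\<^sup>2 / 6 - 1"
    using squares by (rule sums_unique[symmetric])
  also have "\<dots> < 1"
  proof -
    have "pi\<^sup>2 < 3.2\<^sup>2" using pi_approx by (intro power_strict_mono) auto
    thus ?thesis by (simp add: power2_eq_square)
  qed
  finally show False using le1 \<open>riemann_zeta s = 0\<close> by simp
qed

lemma riemann_zeta_2: "riemann_zeta 2 = of_real (pi\<^sup>2 / 6)"
proof -
  have "(\<lambda>n. of_real (1 / (real n + 1)\<^sup>2) :: complex) sums of_real (pi\<^sup>2 / 6)"
    by (intro sums_of_real) (use inverse_squares_sums in \<open>simp add: add_ac\<close>)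
  moreover have "of_nat (Suc n) powr (2 :: complex) = of_nat (Suc n) ^ 2" for n
    using powr_nat'[of "of_nat (Suc n) :: complex" 2] by (simp del: of_nat_Suc)
  ultimately show ?thesis unfolding riemann_zeta_def
    by (simp add: sums_iff add_ac)
qed

text \<open>This is zeta(s) - 1/(s - 1), given by a series that converges absolutely for Re s >
  0.\<close>

definition zeta_reg :: "complex \<Rightarrow> complex" where
  "zeta_reg s = (\<Sum>\<^sub>\<infinity>k\<in>{0<..}. powr_gap (\<lambda>x. x) (of_int k) s)"

lemma norm_powr_gap_id_le:
  assumes "k > 0" "Re s \<ge> \<sigma>" "\<sigma> > 0" "norm s \<le> R"
  shows   "norm (powr_gap (\<lambda>x. x) (of_int k) s) \<le> R * of_int k powr (- (1 + \<sigma>))"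
proof -
  have "norm (powr_gap (\<lambda>x. x) (of_int k) s) \<le> norm s * of_int k powr (- Re s - 1)"
    by (rule norm_powr_gap_le[where p' = "\<lambda>_. 1"])
       (use assms in \<open>auto intro!: powr_mono2' derivative_eq_intros\<close>)
  also have "\<dots> \<le> R * of_int k powr (- (1 + \<sigma>))"
    using assms order.trans[OF norm_ge_zero assms(4)] by (intro mult_mono powr_mono) auto
  finally show ?thesis .
qed

lemma zeta_reg_summable:
  assumes "Re s > 0"
  shows   "(\<lambda>k::int. norm (powr_gap (\<lambda>x. x) (of_int k) s)) summable_on {0<..}"
proof (rule summable_on_comparison_test)
  show "(\<lambda>k. norm s * of_int k powr (- (1 + Re s))) summable_on {0<..}"
    using summable_on_powr_pos_int[of "1 + Re s"] assms by (intro summable_on_cmult_right) auto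
qed (use assms in \<open>auto intro!: norm_powr_gap_id_le simp del: minus_add_distrib\<close>)

lemma has_sum_zeta_reg:
  assumes "Re s > 0"
  shows   "((\<lambda>k. powr_gap (\<lambda>x. x) (of_int k) s) has_sum zeta_reg s) {0<..}"
  unfolding zeta_reg_def
  by (rule has_sum_infsum, rule abs_summable_summable, rule zeta_reg_summable[OF assms])

text \<open>Half the distance to the line Re = c serves as radius. The resulting bounds on real part
  and norm give one exponent and one constant for the whole disc, as a majorant requires.\<close>

lemma cball_Re_bounds:
  assumes "Re z > c"
  obtains r where "r > 0" "\<And>w. w \<in> cball z r \<Longrightarrow> Re w \<ge> (Re z + c) / 2 \<and> norm w \<le> norm z + r"
proof -
  define r where "r = (Re z - c) / 2"
  show ?thesis
  proof (rule that[of r])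
    fix w assume w: "w \<in> cball z r"
    have "Re z - Re w \<le> norm (z - w)" using complex_Re_le_cmod[of "z - w"] by simp
    moreover have "norm w \<le> norm z + norm (z - w)" by norm
    ultimately show "Re w \<ge> (Re z + c) / 2 \<and> norm w \<le> norm z + r"
      using w by (auto simp: dist_norm r_def field_simps)
  qed (use assms in \<open>auto simp: r_def\<close>)
qed

lemma holomorphic_zeta_reg: "zeta_reg holomorphic_on {s. Re s > 0}"
  unfolding zeta_reg_def [abs_def]
proof (rule holomorphic_on_infsum)
  fix z assume z: "z \<in> {s. Re s > 0}"
  then obtain r where r: "r > 0"
     "\<And>w. w \<in> cball z r \<Longrightarrow> Re w \<ge> (Re z + 0) / 2 \<and> norm w \<le> norm z + r"
    using cball_Re_bounds[of 0 z] by auto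
  have *: "Re w \<ge> Re z / 2" "norm w \<le> norm z + r" if "w \<in> cball z r" for w
    using r(2)[OF that] by auto
  show "\<exists>r M. r > 0 \<and> cball z r \<subseteq> {s. Re s > 0} \<and> M summable_on {0<..} \<and>
          (\<forall>k\<in>{0<..}. \<forall>w\<in>cball z r. norm (powr_gap (\<lambda>x. x) (of_int k) w) \<le> M k)"
  proof (intro exI[of _ r] exI[of _ "\<lambda>k. (norm z + r) * of_int k powr (- (1 + Re z / 2))"] conjI ballI)
    show "cball z r \<subseteq> {s. Re s > 0}"
      using * z by fastforce
    show "(\<lambda>k. (norm z + r) * of_int k powr (- (1 + Re z / 2))) summable_on {0<..}"
      using z by (intro summable_on_cmult_right summable_on_powr_pos_int) auto
    show "norm (powr_gap (\<lambda>x. x) (of_int k) w) \<le> (norm z + r) * of_int k powr (- (1 + Re z / 2))"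
      if "k \<in> {0<..}" "w \<in> cball z r" for k w
      using that z * by (intro norm_powr_gap_id_le) auto
  qed (use r(1) in auto)
qed (auto intro!: holomorphic_on_powr_gap simp: open_halfspace_Re_gt)

lemma integral_powr_unit_interval:
  fixes s :: complex
  assumes "a > 0" "s \<noteq> 1"
  shows   "integral {a..a+1} (\<lambda>x. of_real x powr (- s)) =
             (of_real a powr (1 - s) - of_real (a + 1) powr (1 - s)) / (s - 1)"
proof -
  define F :: "real \<Rightarrow> complex" where "F = (\<lambda>x. exp ((1 - s) * of_real (ln x)) / (1 - s))"
  have F: "F x = of_real x powr (1 - s) / (1 - s)" if "x > 0" for x
    using that by (simp add: F_def of_real_powr_eq_exp)
  have "((\<lambda>x. of_real x powr (- s)) has_integral (F (a + 1) - F a)) {a..a+1}"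
  proof (rule fundamental_theorem_of_calculus)
    fix x assume x: "x \<in> {a..a+1}"
    have "((\<lambda>x. of_real (ln x) :: complex) has_vector_derivative of_real (1 / x)) (at x within {a..a+1})"
      using x assms by (intro has_vector_derivative_of_real) (auto intro!: derivative_eq_intros)
    moreover have "((\<lambda>z. exp ((1 - s) * z) / (1 - s)) has_field_derivative exp ((1 - s) * z)) (at z within A)" for z A
      using assms by (auto intro!: derivative_eq_intros)
    ultimately have "((\<lambda>z. exp ((1 - s) * z) / (1 - s)) \<circ> (\<lambda>x. of_real (ln x)) has_vector_derivative
             of_real (1 / x) * exp ((1 - s) * of_real (ln x))) (at x within {a..a+1})"
      by (rule field_vector_diff_chain_within)
    moreover have "of_real (1 / x) * exp ((1 - s) * of_real (ln x)) = of_real x powr (- s)"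
      using x assms by (simp add: of_real_powr_eq_exp left_diff_distrib exp_diff exp_of_real exp_minus field_simps)
    ultimately show "(F has_vector_derivative of_real x powr (- s)) (at x within {a..a+1})"
      by (simp add: F_def o_def)
  qed (use assms in auto)
  hence "integral {a..a+1} (\<lambda>x. of_real x powr (- s)) = F (a + 1) - F a"
    by (rule integral_unique)
  also have "\<dots> = of_real (a + 1) powr (1 - s) / (1 - s) - of_real a powr (1 - s) / (1 - s)"
    using assms(1) by (simp add: F)
  also have "\<dots> = (of_real a powr (1 - s) - of_real (a + 1) powr (1 - s)) / (s - 1)"
    using minus_divide_divide[of _ "1 - s"] by (metis minus_diff_eq diff_divide_distrib)
  finally show ?thesis .
qed

lemma integral_inverse_unit_interval:
  assumes "a > 0"
  shows   "integral {a..a+1} (\<lambda>x. of_real x powr (- 1) :: complex) = of_real (ln (a + 1) - ln a)"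
proof -
  have "((\<lambda>x. of_real (inverse x) :: complex) has_integral of_real (ln (a + 1) - ln a)) {a..a+1}"
    by (intro has_integral_of_real, rule fundamental_theorem_of_calculus)
       (use assms in \<open>auto intro!: derivative_eq_intros simp: field_simps
          simp flip: has_real_derivative_iff_has_vector_derivative\<close>)
  moreover have "of_real x powr (- 1) = (of_real (inverse x) :: complex)" if "x > 0" for x
    using that by (simp add: powr_minus)
  ultimately have "((\<lambda>x. of_real x powr (- 1) :: complex) has_integral of_real (ln (a + 1) - ln a)) {a..a+1}"
    using assms by (subst has_integral_cong) auto
  thus ?thesis by (rule integral_unique)
qed

text \<open>At s = 1 the k-th difference is 1/k - (ln (k+1) - ln k), and the partial sums are
  harmonic numbers minus logarithms.\<close>

lemma zeta_reg_1: "zeta_reg 1 = euler_mascheroni"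
proof -
  have "((\<lambda>k. powr_gap (\<lambda>x. x) (of_int k) 1) has_sum zeta_reg 1) {0<..}"
    by (rule has_sum_zeta_reg) simp
  hence "(\<lambda>n. powr_gap (\<lambda>x. x) (of_int (int (Suc n))) 1) sums zeta_reg 1"
    unfolding has_sum_pos_int_iff by (rule has_sum_imp_sums)
  also have "(\<lambda>n. powr_gap (\<lambda>x. x) (of_int (int (Suc n))) 1) = (\<lambda>n. inverse (of_nat (n+1)) +
               of_real (ln (of_nat (n+1))) - of_real (ln (of_nat (n+2))))"
  proof
    fix n
    have "powr_gap (\<lambda>x. x) (real (Suc n)) 1 =
            inverse (of_nat (Suc n)) - of_real (ln (real (Suc n) + 1) - ln (real (Suc n)))"
      unfolding powr_gap_def
      by (subst integral_inverse_unit_interval) (auto simp: powr_minus simp del: of_nat_Suc)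
    thus "powr_gap (\<lambda>x. x) (of_int (int (Suc n))) 1 = inverse (of_nat (n+1)) +
               of_real (ln (of_nat (n+1))) - of_real (ln (of_nat (n+2)))"
      by (simp add: add_ac)
  qed
  finally show ?thesis
    using euler_mascheroni_sum sums_unique2 by blast
qed

text \<open>Unordered summability comes for free, the integrals being differences of two summable
  families. Only the value needs an ordered argument: the integrals telescope, and n^(1-s) tends to
  0.\<close>

lemma has_sum_integral_powr:
  assumes s: "Re s > 1"
  shows   "((\<lambda>k. integral {of_int k..of_int k + 1} (\<lambda>x. of_real x powr (- s))) has_sum
              1 / (s - 1)) {0<..}"
    (is "(?g has_sum _) _")
proof -
  have s': "s \<noteq> 1" using s by auto
  have "((\<lambda>k. of_real (of_int k) powr (- s) - powr_gap (\<lambda>x. x) (of_int k) s) has_sum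
          riemann_zeta s - zeta_reg s) {0<..}"
    by (intro has_sum_diff has_sum_riemann_zeta has_sum_zeta_reg) (use s in auto)
  also have "(\<lambda>k. of_real (of_int k) powr (- s) - powr_gap (\<lambda>x. x) (of_int k) s) = ?g"
    by (simp add: powr_gap_def)
  finally have *: "(?g has_sum riemann_zeta s - zeta_reg s) {0<..}" .
  hence "(\<lambda>n. ?g (int (Suc n))) sums (riemann_zeta s - zeta_reg s)"
    unfolding has_sum_pos_int_iff by (rule has_sum_imp_sums)
  also have "(\<lambda>n. ?g (int (Suc n))) = (\<lambda>n. of_nat (Suc n) powr (1 - s) / (s - 1) -
               of_nat (Suc (Suc n)) powr (1 - s) / (s - 1))"
  proof
    fix n
    have "?g (int (Suc n)) = (of_real (real (Suc n)) powr (1 - s) - of_real (real (Suc n) + 1) powr (1 - s)) / (s - 1)"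
      using integral_powr_unit_interval[of "real (Suc n)" s] s' by simp
    thus "?g (int (Suc n)) = of_nat (Suc n) powr (1 - s) / (s - 1) -
            of_nat (Suc (Suc n)) powr (1 - s) / (s - 1)"
      by (simp add: diff_divide_distrib add_ac)
  qed
  finally have **: "(\<lambda>n. of_nat (Suc n) powr (1 - s) / (s - 1) - of_nat (Suc (Suc n)) powr (1 - s) / (s - 1))
                 sums (riemann_zeta s - zeta_reg s)" .
  have "(\<lambda>n. of_nat n powr (1 - s) / (s - 1)) \<longlonglongrightarrow> 0 / (s - 1)"
    by (intro tendsto_divide tendsto_const tendsto_neg_powr_complex_of_nat)
       (use s in \<open>auto intro: filterlim_ident\<close>)
  hence "(\<lambda>n. of_nat (Suc n) powr (1 - s) / (s - 1)) \<longlonglongrightarrow> 0"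
    by (subst filterlim_sequentially_Suc) auto
  from telescope_sums'[OF this] have "(\<lambda>n. of_nat (Suc n) powr (1 - s) / (s - 1) -
      of_nat (Suc (Suc n)) powr (1 - s) / (s - 1)) sums (1 / (s - 1))"
    by simp
  with ** have "riemann_zeta s - zeta_reg s = 1 / (s - 1)"
    using sums_unique2 by blast
  with * show ?thesis by simp
qed

lemma riemann_zeta_eq_zeta_reg:
  assumes "Re s > 1"
  shows   "riemann_zeta s = 1 / (s - 1) + zeta_reg s"
proof -
  have "((\<lambda>k. powr_gap (\<lambda>x. x) (of_int k) s) has_sum riemann_zeta s - 1 / (s - 1)) {0<..}"
    unfolding powr_gap_def
    by (intro has_sum_diff has_sum_riemann_zeta has_sum_integral_powr assms)
  thus ?thesis unfolding zeta_reg_def by (simp add: infsumI)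
qed

lemma holomorphic_riemann_zeta: "riemann_zeta holomorphic_on {s. Re s > 1}"
proof -
  have "(\<lambda>s. 1 / (s - 1) + zeta_reg s) holomorphic_on {s. Re s > 1}"
    by (intro holomorphic_intros holomorphic_on_subset[OF holomorphic_zeta_reg]) auto
  thus ?thesis
    by (rule holomorphic_transform) (simp add: riemann_zeta_eq_zeta_reg)
qed

subsection \<open>The lattice sum minus its integral\<close>

text \<open>
  Weakening \<open>m\<^sup>2 + n\<^sup>2\<close> to a product lets the double sum factor into two single sums, without losing
  the optimal range of exponents.
\<close>

lemma norm_form_lower_bound:
  assumes "Im \<tau> > 0"
  obtains C where "0 < C" "C \<le> 1" "\<And>m n x. m > 0 \<Longrightarrow> x \<in> {of_int n..of_int n + 1} \<Longrightarrow>
    C * (of_int m * max 1 \<bar>of_int n\<bar>) \<le> norm_form \<tau> m x"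
proof -
  define u v where "u = Re \<tau>" "v = Im \<tau>"
  have v: "v > 0" using assms by (simp add: u_v_def)
  \<comment> \<open>K collects the factors of the estimate below: x^2 is at most 2(x + Mu)^2 +
    2(Mu)^2, so 2(x^2 + M^2) is at most 4Q + (4u^2 + 2) M^2, and M^2 is at most Q / v^2. Moreover K
    \<ge> 1 makes the constant 1/K at most 1.\<close>
  define K where "K = 4 + (4 * u\<^sup>2 + 2) / v\<^sup>2"
  have K: "K \<ge> 4" using v by (simp add: K_def)
  show ?thesis
  proof (rule that[of "1 / K"])
    fix m n :: int and x :: real
    assume m: "m > 0" and x: "x \<in> {of_int n..of_int n + 1}"
    define Q where "Q = norm_form \<tau> m x"
    define M where "M = real_of_int m"
    have Q: "Q = (x + M * u)\<^sup>2 + (M * v)\<^sup>2"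
      by (simp add: Q_def M_def norm_form_altdef u_v_def)
    have M: "M \<ge> 1" using m by (simp add: M_def)
    have "\<bar>real_of_int n\<bar> \<le> \<bar>x\<bar> + 1" using x by auto
    hence "max 1 \<bar>real_of_int n\<bar> \<le> \<bar>x\<bar> + M" using M by auto
    hence "M * max 1 \<bar>real_of_int n\<bar> \<le> M * (\<bar>x\<bar> + M)" using M by (intro mult_left_mono) auto
    also have "\<dots> \<le> 2 * (x\<^sup>2 + M\<^sup>2)"
    proof -
      have "0 \<le> (\<bar>x\<bar> - M)\<^sup>2" by simp
      hence "2 * (M * \<bar>x\<bar>) \<le> x\<^sup>2 + M\<^sup>2"
        by (simp only: power2_diff power2_abs) (simp add: algebra_simps)
      thus ?thesis using zero_le_power2[of x] zero_le_power2[of M]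
        unfolding distrib_left power2_eq_square[of M, symmetric] by linarith
    qed
    also have "x\<^sup>2 \<le> 2 * (x + M * u)\<^sup>2 + 2 * (M * u)\<^sup>2"
      using zero_le_power2[of "x + 2 * (M * u)"] by (simp add: power2_eq_square algebra_simps)
    also have "(x + M * u)\<^sup>2 \<le> Q" by (simp add: Q)
    also have "(M * u)\<^sup>2 = (u\<^sup>2 / v\<^sup>2) * (M * v)\<^sup>2" using v by (simp add: power_mult_distrib)
    also have "M\<^sup>2 = (1 / v\<^sup>2) * (M * v)\<^sup>2" using v by (simp add: power_mult_distrib)
    also have "2 * (2 * Q + 2 * (u\<^sup>2 / v\<^sup>2 * (M * v)\<^sup>2) + 1 / v\<^sup>2 * (M * v)\<^sup>2) =
                 4 * Q + (4 * u\<^sup>2 + 2) / v\<^sup>2 * (M * v)\<^sup>2"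
      by (simp add: algebra_simps add_divide_distrib)
    also have "\<dots> \<le> 4 * Q + (4 * u\<^sup>2 + 2) / v\<^sup>2 * Q"
      by (intro add_left_mono mult_left_mono) (auto simp: Q)
    also have "\<dots> = K * Q" by (simp add: K_def algebra_simps)
    finally show "1 / K * (real_of_int m * max 1 \<bar>real_of_int n\<bar>) \<le> norm_form \<tau> m x"
      using K by (simp add: M_def Q_def field_simps)
  qed (use K in auto)
qed

section \<open>Majorants for sums over the half-lattice\<close>

abbreviation lattice_weight :: "int \<times> int \<Rightarrow> real" where
  "lattice_weight \<equiv> \<lambda>(m, n). of_int m * max 1 \<bar>of_int n\<bar>"

lemma lattice_weight_ge_1: "x \<in> {0<..} \<times> UNIV \<Longrightarrow> lattice_weight x \<ge> 1"
proof -
  assume "x \<in> {0<..} \<times> UNIV"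
  then obtain m n where [simp]: "x = (m, n)" and "m > 0" by auto
  hence "1 * 1 \<le> of_int m * max 1 \<bar>real_of_int n\<bar>" by (intro mult_mono) auto
  thus ?thesis by simp
qed

lemma summable_on_powr_int:
  assumes "p > 1"
  shows   "(\<lambda>n::int. max 1 \<bar>of_int n\<bar> powr (- p) :: real) summable_on UNIV"
proof -
  define f :: "int \<Rightarrow> real" where "f = (\<lambda>n. max 1 \<bar>of_int n\<bar> powr (- p))"
  have pos: "f summable_on {0<..}"
    using summable_on_powr_pos_int[OF assms]
    by (rule summable_on_cong[THEN iffD1, rotated]) (auto simp: f_def)
  moreover have "f summable_on {..<0}"
    using pos summable_on_reindex_bij_betw[of uminus "{0<..}" "{..<0}" f]
    by (simp add: f_def bij_betw_def image_uminus_greaterThan)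
  moreover have "f summable_on {0}" by simp
  ultimately have "f summable_on ({0<..} \<union> {..<0} \<union> {0})"
    by (intro summable_on_Un_disjoint) auto
  also have "{0<..} \<union> {..<0} \<union> {0} = (UNIV :: int set)" by auto
  finally show ?thesis by (simp add: f_def)
qed

text \<open>The power of the weight is a product of a function of m and a function of n, so the row
  sums are constant multiples of m^(-p).\<close>

lemma summable_on_lattice_weight:
  assumes "p > 1"
  shows   "(\<lambda>x. lattice_weight x powr (- p)) summable_on {0<..} \<times> UNIV"
proof (rule summable_on_SigmaI)
  define S :: real where "S = (\<Sum>\<^sub>\<infinity>n::int. max 1 \<bar>of_int n\<bar> powr (- p))"
  show "((\<lambda>n. lattice_weight (m, n) powr (- p)) has_sum (of_int m powr (- p) * S)) UNIV"
    if "m \<in> {0<..}" for m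
  proof -
    have "((\<lambda>n. of_int m powr (- p) * max 1 \<bar>of_int n\<bar> powr (- p)) has_sum
            (of_int m powr (- p) * S)) UNIV"
      unfolding S_def by (intro has_sum_cmult_right has_sum_infsum summable_on_powr_int assms)
    thus ?thesis using that by (simp add: powr_mult)
  qed
  show "(\<lambda>m. of_int m powr (- p) * S) summable_on {0<..}"
    by (intro summable_on_cmult_left summable_on_powr_pos_int assms)
qed auto

text \<open>Uniformity in the exponent: since C \<le> 1, its negative powers grow and are largest at
  R; since t \<ge> 1, its negative powers shrink and are largest at the smallest exponent
  \<open>\<sigma>'\<close>.\<close>

lemma powr_neg_le_of_lower_bound:
  fixes y t C \<sigma> \<sigma>' R :: real
  assumes "C * t \<le> y" "0 < C" "C \<le> 1" "1 \<le> t" "0 \<le> \<sigma>'" "\<sigma>' \<le> \<sigma>" "\<sigma> \<le> R"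
  shows   "y powr (- \<sigma>) \<le> C powr (- R) * t powr (- \<sigma>')"
proof -
  have "y powr (- \<sigma>) \<le> (C * t) powr (- \<sigma>)"
    using assms by (intro powr_mono2') auto
  also have "\<dots> = C powr (- \<sigma>) * t powr (- \<sigma>)"
    using assms by (simp add: powr_mult)
  also have "\<dots> \<le> C powr (- R) * t powr (- \<sigma>')"
    using assms by (intro mult_mono powr_mono powr_mono') auto
  finally show ?thesis .
qed

lemma continuous_on_norm_form: "continuous_on A (norm_form \<tau> m)"
  unfolding norm_form_altdef [abs_def] by (intro continuous_intros)

text \<open>The derivative 2(x + m Re \<tau>) of the norm form is at most twice the square root of
  the norm form. One power lost in differentiating, against half a power regained, turns the
  exponent \<sigma> into \<sigma> + 1/2.\<close>

lemma norm_powr_gap_norm_form_le: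
  assumes "0 < C" "C \<le> 1" "1 \<le> t"
  assumes C: "\<And>x. x \<in> {a..a+1} \<Longrightarrow> C * t \<le> norm_form \<tau> m x"
  assumes s: "0 \<le> \<sigma>" "\<sigma> \<le> Re s" "norm s \<le> R"
  shows   "norm (powr_gap (norm_form \<tau> m) a s) \<le> 2 * R * C powr (- R - 1/2) * t powr (- \<sigma> - 1/2)"
proof -
  have Re: "Re s \<le> norm s" by (rule complex_Re_le_cmod)
  have pos: "norm_form \<tau> m x > 0" if "x \<in> {a..a+1}" for x
  proof -
    have "0 < C * t" using assms by simp
    also have "\<dots> \<le> norm_form \<tau> m x" by (rule C[OF that])
    finally show ?thesis .
  qed
  have "norm (powr_gap (norm_form \<tau> m) a s) \<le>
          norm s * (2 * (C powr (- (R + 1/2)) * t powr (- (\<sigma> + 1/2))))"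
  proof (rule norm_powr_gap_le)
    show "(norm_form \<tau> m has_real_derivative 2 * (x + of_int m * Re \<tau>)) (at x within {a..a+1})" for x
      unfolding norm_form_altdef [abs_def] by (auto intro!: derivative_eq_intros)
    fix x assume x: "x \<in> {a..a+1}"
    have "\<bar>x + of_int m * Re \<tau>\<bar> = sqrt ((x + of_int m * Re \<tau>)\<^sup>2)" by simp
    also have "\<dots> \<le> sqrt (norm_form \<tau> m x)" by (subst real_sqrt_le_iff) (simp add: norm_form_altdef)
    also have "\<dots> = norm_form \<tau> m x powr (1/2)" using pos[OF x] by (simp add: powr_half_sqrt)
    finally have "\<bar>2 * (x + of_int m * Re \<tau>)\<bar> * norm_form \<tau> m x powr (- Re s - 1) \<le>
                    2 * norm_form \<tau> m x powr (1/2) * norm_form \<tau> m x powr (- Re s - 1)"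
      by (intro mult_right_mono) (simp_all add: abs_mult)
    also have "\<dots> = 2 * norm_form \<tau> m x powr (- (Re s + 1/2))"
    proof -
      have "- (Re s + 1/2) = 1/2 + (- Re s - 1)" by simp
      thus ?thesis by (simp only: powr_add mult.assoc)
    qed
    also have "norm_form \<tau> m x powr (- (Re s + 1/2)) \<le>
                 C powr (- (R + 1/2)) * t powr (- (\<sigma> + 1/2))"
      by (rule powr_neg_le_of_lower_bound[OF C[OF x]]) (use assms Re in auto)
    finally show "\<bar>2 * (x + of_int m * Re \<tau>)\<bar> * norm_form \<tau> m x powr (- Re s - 1) \<le>
                    2 * (C powr (- (R + 1/2)) * t powr (- (\<sigma> + 1/2)))" by simp
  qed (use pos in auto)
  also have "\<dots> \<le> R * (2 * (C powr (- (R + 1/2)) * t powr (- (\<sigma> + 1/2))))"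
    using s by (intro mult_right_mono) auto
  also have "- (R + 1/2) = - R - 1/2" by simp
  also have "- (\<sigma> + 1/2) = - \<sigma> - 1/2" by simp
  finally show ?thesis by (simp only: mult_ac)
qed

definition lattice_gap :: "complex \<Rightarrow> complex \<Rightarrow> complex" where
  "lattice_gap \<tau> s =
     (\<Sum>\<^sub>\<infinity>(m, n)\<in>{0<..} \<times> UNIV. powr_gap (norm_form \<tau> m) (of_int n) s)"

context
  fixes \<tau> :: complex
  assumes tau: "Im \<tau> > 0"
begin

lemma lattice_gap_bound:
  assumes "0 \<le> \<sigma>"
  obtains B where "\<And>m n s. m > 0 \<Longrightarrow> \<sigma> \<le> Re s \<Longrightarrow> norm s \<le> R \<Longrightarrow>
     norm (powr_gap (norm_form \<tau> m) (of_int n) s) \<le> B * lattice_weight (m, n) powr (- (\<sigma> + 1/2))"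
proof -
  from norm_form_lower_bound[OF tau] obtain C where C: "0 < C" "C \<le> 1"
    "\<And>m n x. m > 0 \<Longrightarrow> x \<in> {of_int n..of_int n + 1} \<Longrightarrow>
       C * (of_int m * max 1 \<bar>of_int n\<bar>) \<le> norm_form \<tau> m x" by metis
  show ?thesis
  proof (rule that[of "2 * R * C powr (- R - 1/2)"])
    fix m n :: int and s :: complex
    assume *: "m > 0" "\<sigma> \<le> Re s" "norm s \<le> R"
    have "norm (powr_gap (norm_form \<tau> m) (of_int n) s) \<le>
            2 * R * C powr (- R - 1/2) * lattice_weight (m, n) powr (- \<sigma> - 1/2)"
      by (rule norm_powr_gap_norm_form_le)
         (use C(1,2) C(3)[of m _ n] * assms lattice_weight_ge_1[of "(m, n)"] in simp_all)
    thus "norm (powr_gap (norm_form \<tau> m) (of_int n) s) \<le>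
            2 * R * C powr (- R - 1/2) * lattice_weight (m, n) powr (- (\<sigma> + 1/2))" by simp
  qed
qed

text \<open>The point x ranges over the whole unit interval because the bound serves both the
  lattice terms themselves and the integrals between consecutive integers.\<close>

lemma lattice_term_bound:
  assumes "0 \<le> \<sigma>"
  obtains B where "\<And>m n s x. m > 0 \<Longrightarrow> \<sigma> \<le> Re s \<Longrightarrow> norm s \<le> R \<Longrightarrow> x \<in> {of_int n..of_int n + 1} \<Longrightarrow>
     norm (of_real (norm_form \<tau> m x) powr (- s)) \<le> B * lattice_weight (m, n) powr (- \<sigma>)"
proof -
  from norm_form_lower_bound[OF tau] obtain C where C: "0 < C" "C \<le> 1"
    "\<And>m n x. m > 0 \<Longrightarrow> x \<in> {of_int n..of_int n + 1} \<Longrightarrow>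
       C * (of_int m * max 1 \<bar>of_int n\<bar>) \<le> norm_form \<tau> m x" by metis
  show ?thesis
  proof (rule that[of "C powr (- R)"])
    fix m n :: int and s :: complex and x :: real
    assume *: "m > 0" "\<sigma> \<le> Re s" "norm s \<le> R" "x \<in> {of_int n..of_int n + 1}"
    have "Re s \<le> R" using complex_Re_le_cmod[of s] * by simp
    have "norm (of_real (norm_form \<tau> m x) powr (- s)) = norm_form \<tau> m x powr (- Re s)"
      by (subst norm_of_real_powr) (auto simp: norm_form_def)
    also have "\<dots> \<le> C powr (- R) * lattice_weight (m, n) powr (- \<sigma>)"
      by (rule powr_neg_le_of_lower_bound)
         (use C(1,2) C(3)[of m x n] * assms lattice_weight_ge_1[of "(m, n)"] \<open>Re s \<le> R\<close> in simp_all)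
    finally show "norm (of_real (norm_form \<tau> m x) powr (- s)) \<le>
                    C powr (- R) * lattice_weight (m, n) powr (- \<sigma>)" .
  qed
qed

lemma lattice_term_summable:
  assumes "Re s > 1"
  shows   "(\<lambda>(m, n). of_real (norm_form \<tau> m (of_int n)) powr (- s)) summable_on {0<..} \<times> UNIV"
proof -
  obtain B where B: "\<And>m n s' x. m > 0 \<Longrightarrow> Re s \<le> Re s' \<Longrightarrow> norm s' \<le> norm s \<Longrightarrow> x \<in> {of_int n..of_int n + 1} \<Longrightarrow>
     norm (of_real (norm_form \<tau> m x) powr (- s')) \<le> B * lattice_weight (m, n) powr (- Re s)"
    using lattice_term_bound[of "Re s" "norm s"] assms by auto
  have "(\<lambda>x. norm (case x of (m, n) \<Rightarrow> of_real (norm_form \<tau> m (of_int n)) powr (- s)))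
           summable_on {0<..} \<times> UNIV"
  proof (rule summable_on_comparison_test)
    show "(\<lambda>x. B * lattice_weight x powr (- Re s)) summable_on {0<..} \<times> UNIV"
      by (intro summable_on_cmult_right summable_on_lattice_weight assms)
  qed (use B[where s' = s] in auto)
  thus ?thesis by (rule abs_summable_summable)
qed

lemma lattice_gap_summable:
  assumes "Re s > 1/2"
  shows   "(\<lambda>(m, n). powr_gap (norm_form \<tau> m) (of_int n) s) summable_on {0<..} \<times> UNIV"
proof -
  obtain B where B: "\<And>m n s'. m > 0 \<Longrightarrow> Re s \<le> Re s' \<Longrightarrow> norm s' \<le> norm s \<Longrightarrow>
     norm (powr_gap (norm_form \<tau> m) (of_int n) s') \<le> B * lattice_weight (m, n) powr (- (Re s + 1/2))"
    using lattice_gap_bound[of "Re s" "norm s"] assms by auto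
  have "(\<lambda>x. norm (case x of (m, n) \<Rightarrow> powr_gap (norm_form \<tau> m) (of_int n) s))
           summable_on {0<..} \<times> UNIV"
  proof (rule summable_on_comparison_test)
    show "(\<lambda>x. B * lattice_weight x powr (- (Re s + 1/2))) summable_on {0<..} \<times> UNIV"
      using assms by (intro summable_on_cmult_right summable_on_lattice_weight) auto
  qed (use B[where s' = s] in auto)
  thus ?thesis by (rule abs_summable_summable)
qed

lemma holomorphic_lattice_gap: "lattice_gap \<tau> holomorphic_on {s. Re s > 1/2}"
  unfolding lattice_gap_def [abs_def] case_prod_unfold
proof (rule holomorphic_on_infsum)
  fix z assume z: "z \<in> {s. Re s > 1/2}"
  then obtain r where r: "r > 0"
     "\<And>w. w \<in> cball z r \<Longrightarrow> Re w \<ge> (Re z + 1/2) / 2 \<and> norm w \<le> norm z + r"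
    using cball_Re_bounds[of "1/2" z] by auto
  \<comment> \<open>The midpoint between 1/2 and Re z: the exponent \<open>\<sigma> + 1/2\<close> of
    the majorant still exceeds 1.\<close>
  define \<sigma> where "\<sigma> = (Re z + 1/2) / 2"
  have \<sigma>: "\<sigma> > 1/2" using z by (simp add: \<sigma>_def)
  have *: "Re w \<ge> \<sigma>" "norm w \<le> norm z + r" if "w \<in> cball z r" for w
    using r(2)[OF that] by (auto simp: \<sigma>_def)
  obtain B where B: "\<And>m n s. m > 0 \<Longrightarrow> \<sigma> \<le> Re s \<Longrightarrow> norm s \<le> norm z + r \<Longrightarrow>
     norm (powr_gap (norm_form \<tau> m) (of_int n) s) \<le> B * lattice_weight (m, n) powr (- (\<sigma> + 1/2))"
    using lattice_gap_bound[of \<sigma> "norm z + r"] \<sigma> by auto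
  show "\<exists>r M. r > 0 \<and> cball z r \<subseteq> {s. Re s > 1/2} \<and> M summable_on {0<..} \<times> UNIV \<and>
          (\<forall>x\<in>{0<..} \<times> UNIV. \<forall>w\<in>cball z r. norm (powr_gap (norm_form \<tau> (fst x)) (of_int (snd x)) w) \<le> M x)"
  proof (intro exI[of _ r] exI[of _ "\<lambda>x. B * lattice_weight x powr (- (\<sigma> + 1/2))"] conjI ballI)
    show "cball z r \<subseteq> {s. Re s > 1/2}"
      using * \<sigma> by fastforce
    show "(\<lambda>x. B * lattice_weight x powr (- (\<sigma> + 1/2))) summable_on {0<..} \<times> UNIV"
      using \<sigma> by (intro summable_on_cmult_right summable_on_lattice_weight) auto
    show "norm (powr_gap (norm_form \<tau> (fst x)) (of_int (snd x)) w) \<le>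
            B * lattice_weight x powr (- (\<sigma> + 1/2))"
      if "x \<in> {0<..} \<times> UNIV" "w \<in> cball z r" for x w
      using B[of "fst x" w "snd x"] *[OF that(2)] that(1) by (auto simp: case_prod_unfold)
  qed (use r(1) in auto)
next
  fix x :: "int \<times> int" assume "x \<in> {0<..} \<times> UNIV"
  thus "powr_gap (norm_form \<tau> (fst x)) (of_int (snd x)) holomorphic_on {s. Re s > 1/2}"
    by (intro holomorphic_on_powr_gap continuous_on_norm_form norm_form_pos tau) auto
qed (rule open_halfspace_Re_gt)

end

subsection \<open>The integral over the line\<close>

text \<open>Half-open intervals partition the line, while the comparison integrals run over closed
  ones; the extra endpoint is a null set.\<close>

lemma integral_halfopen_eq:
  fixes f :: "real \<Rightarrow> 'a :: euclidean_space"
  assumes "integrable lborel f"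
  shows   "(LINT x:{a..<b}|lborel. f x) = integral {a..b} f"
proof -
  have "set_integrable lborel {a..<b} f"
    unfolding set_integrable_def using assms by (intro integrable_mult_indicator) auto
  hence "(LINT x:{a..<b}|lborel. f x) = integral {a..<b} f"
    by (rule set_borel_integral_eq_integral)
  also have "\<dots> = integral {a..b} f"
    by (rule integral_spike_set) (rule negligible_subset[of "{b}"]; force)+
  finally show ?thesis .
qed

text \<open>Finite sums of norms of the pieces are bounded by the integral of the norm of f, since
  each x lies in exactly one piece. This gives absolute summability, and countable additivity gives
  the value.\<close>

lemma has_sum_integral_unit_intervals:
  fixes f :: "real \<Rightarrow> complex"
  assumes "integrable lborel f"
  shows   "((\<lambda>n::int. integral {of_int n..of_int n + 1} f) has_sum (LINT x|lborel. f x)) UNIV"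
proof -
  define A :: "int \<Rightarrow> real set" where "A = (\<lambda>n. {of_int n..<of_int n + 1})"
  have A_sets [simp]: "A n \<in> sets borel" for n by (simp add: A_def)
  have in_A: "x \<in> A n \<longleftrightarrow> n = \<lfloor>x\<rfloor>" for x n
    by (auto simp: A_def intro: floor_unique[symmetric])
  define g where "g = (\<lambda>n. LINT x:A n|lborel. f x)"
  have set_int: "set_integrable lborel (A n) f" for n
    unfolding set_integrable_def using assms by (intro integrable_mult_indicator) auto
  have "(\<lambda>n. norm (g n)) summable_on UNIV"
  proof (rule nonneg_bdd_above_summable_on)
    show "bdd_above (sum (\<lambda>n. norm (g n)) ` {F. F \<subseteq> UNIV \<and> finite F})"
    proof (rule bdd_aboveI2, clarify)
      fix F :: "int set" assume F: "finite F"
      have "(\<Sum>n\<in>F. norm (g n)) \<le> (\<Sum>n\<in>F. LINT x|lborel. indicator (A n) x *\<^sub>R norm (f x))"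
        unfolding g_def using set_integral_norm_bound[OF set_int]
        by (intro sum_mono) (simp add: set_lebesgue_integral_def)
      also have "\<dots> = (LINT x|lborel. (\<Sum>n\<in>F. indicator (A n) x *\<^sub>R norm (f x)))"
        using assms by (intro Bochner_Integration.integral_sum[symmetric] integrable_mult_indicator) auto
      also have "\<dots> \<le> (LINT x|lborel. norm (f x))"
      proof (rule integral_mono)
        show "integrable lborel (\<lambda>x. \<Sum>n\<in>F. indicator (A n) x *\<^sub>R norm (f x))"
          using assms by (intro Bochner_Integration.integrable_sum integrable_mult_indicator) auto
        fix x
        have "(\<Sum>n\<in>F. indicator (A n) x *\<^sub>R norm (f x)) = (\<Sum>n\<in>F. if n = \<lfloor>x\<rfloor> then norm (f x) else 0)"
          by (intro sum.cong) (auto simp: indicator_def in_A)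
        also have "\<dots> \<le> norm (f x)" using F by simp
        finally show "(\<Sum>n\<in>F. indicator (A n) x *\<^sub>R norm (f x)) \<le> norm (f x)" .
      qed (use assms in auto)
      finally show "(\<Sum>n\<in>F. norm (g n)) \<le> (LINT x|lborel. norm (f x))" .
    qed
  qed auto
  hence "g summable_on UNIV" by (rule abs_summable_summable)
  then obtain S where S: "(g has_sum S) UNIV" by (auto simp: summable_on_def)
  \<comment> \<open>Once the unordered sum exists, any enumeration of the integers computes
    it.\<close>
  hence "((\<lambda>i. g (int_decode i)) has_sum S) UNIV"
    using has_sum_reindex_bij_betw[OF bij_int_decode, of g S] by simp
  hence "(\<lambda>i. g (int_decode i)) sums S" by (rule has_sum_imp_sums)
  moreover have "(LINT x:(\<Union>i. A (int_decode i))|lborel. f x) = (\<Sum>i. g (int_decode i))"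
    unfolding g_def
  proof (rule lebesgue_integral_countable_add)
    show "A (int_decode i) \<inter> A (int_decode j) = {}" if "i \<noteq> j" for i j
      using that int_decode_eq[of i j] by (auto simp: in_A simp del: int_decode_eq)
    show "set_integrable lborel (\<Union>i. A (int_decode i)) f"
      unfolding set_integrable_def using assms by (intro integrable_mult_indicator) auto
  qed auto
  moreover have "(\<Union>i. A (int_decode i)) = UNIV"
  proof -
    have "x \<in> A (int_decode (int_encode \<lfloor>x\<rfloor>))" for x by (simp add: in_A)
    thus ?thesis by blast
  qed
  ultimately have "S = (LINT x|lborel. f x)"
    by (simp add: sums_iff set_lebesgue_integral_def)
  moreover have "g = (\<lambda>n. integral {of_int n..of_int n + 1} f)"
    unfolding g_def A_def integral_halfopen_eq[OF assms] ..
  ultimately show ?thesis using S by simp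
qed

text \<open>With x^2 = t / (1 - t) the integrand becomes (1 - t)^\<sigma>, and the derivative of the
  substitution is t^(-1/2) (1 - t)^(-3/2) / 2: half of the Beta density with parameters 1/2 and
  \<sigma> - 1/2.\<close>

lemma half_line_integral_powr:
  fixes \<sigma> :: real
  assumes "\<sigma> > 1/2"
  shows   "set_integrable lborel {0<..} (\<lambda>x. (1 + x\<^sup>2) powr (- \<sigma>))"
    and   "(LINT x:{0<..}|lborel. (1 + x\<^sup>2) powr (- \<sigma>)) = Beta (1/2) (\<sigma> - 1/2) / 2"
proof -
  define b where "b = (\<lambda>t::real. t powr (1/2 - 1) * (1 - t) powr (\<sigma> - 1/2 - 1))"
  have "(b has_integral Beta (1/2) (\<sigma> - 1/2)) {0..1}"
    unfolding b_def using assms by (intro has_integral_Beta_real) auto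
  hence b: "(b has_integral Beta (1/2) (\<sigma> - 1/2)) {0<..<1}"
    by (simp add: has_integral_Icc_iff_Ioo)
  have "b absolutely_integrable_on {0<..<1}"
    using b by (intro nonnegative_absolutely_integrable_1) (auto simp: b_def)
  hence "set_integrable lborel {0<..<1} b"
    unfolding set_integrable_def by (subst (asm) integrable_completion) (auto simp: b_def)
  hence int_b: "set_integrable lborel {0<..<1} (\<lambda>t. b t / 2)" by simp
  have val_b: "(LINT t:{0<..<1}|lborel. b t / 2) = Beta (1/2) (\<sigma> - 1/2) / 2"
    using int_b b by (subst set_borel_integral_eq_integral) (auto simp: has_integral_iff)
  \<comment> \<open>The substitution \<open>x = h t\<close> turns \<open>1 + x\<^sup>2\<close> into \<open>1 / (1 - t)\<close>.\<close>
  define h where "h = (\<lambda>t::real. sqrt (t / (1 - t)))"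
  define h' where "h' = (\<lambda>t::real. t powr (-1/2) * (1 - t) powr (-3/2) / 2)"
  define f where "f = (\<lambda>x::real. (1 + x\<^sup>2) powr (- \<sigma>))"
  have h': "DERIV h t :> h' t" if "0 < t" "t < 1" for t
  proof -
    have "DERIV h t :> (inverse (sqrt (t / (1 - t))) / 2) * ((1 * (1 - t) - t * (0 - 1)) / ((1 - t) * (1 - t)))"
      unfolding h_def
    proof (rule DERIV_chain2[OF DERIV_real_sqrt])
      show "DERIV (\<lambda>t. t / (1 - t)) t :> (1 * (1 - t) - t * (0 - 1)) / ((1 - t) * (1 - t))"
        using that by (intro derivative_intros) auto
    qed (use that in auto)
    also have "(inverse (sqrt (t / (1 - t))) / 2) * ((1 * (1 - t) - t * (0 - 1)) / ((1 - t) * (1 - t))) = h' t"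
    proof -
      have 1: "sqrt (t / (1 - t)) = t powr (1/2) / (1 - t) powr (1/2)"
        using that by (simp add: powr_half_sqrt real_sqrt_divide)
      have 2: "t powr (-1/2) = inverse (t powr (1/2))" by (simp add: powr_minus)
      have 3: "(1 - t) powr (-3/2) = (1 - t) powr (1/2) / ((1 - t) * (1 - t))"
      proof -
        have "(1 - t) powr (-3/2) = (1 - t) powr (1/2 - 2)" by simp
        also have "\<dots> = (1 - t) powr (1/2) / (1 - t) powr 2" by (rule powr_diff)
        also have "(1 - t) powr 2 = (1 - t) * (1 - t)" using that by (simp add: powr_numeral power2_eq_square)
        finally show ?thesis .
      qed
      show ?thesis unfolding h'_def 1 2 3 by (simp add: field_simps)
    qed
    finally show ?thesis .
  qed
  have fh: "f (h t) * h' t = b t / 2" if "0 < t" "t < 1" for t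
  proof -
    have "1 + (h t)\<^sup>2 = 1 / (1 - t)" using that by (simp add: h_def field_simps)
    hence "f (h t) = (1 - t) powr \<sigma>"
      using that by (simp add: f_def powr_divide powr_minus_divide)
    moreover have "(1 - t) powr (\<sigma> - 1/2 - 1) = (1 - t) powr \<sigma> * (1 - t) powr (-3/2)"
      by (simp flip: powr_add)
    ultimately show ?thesis by (simp add: h'_def b_def)
  qed
  have einterval: "einterval 0 1 = {0<..<1}" "einterval 0 \<infinity> = {0<..}"
    by (auto simp: einterval_def)
  have contf: "isCont f (h t)" for t
    unfolding f_def by (intro continuous_intros) (auto simp: add_nonneg_eq_0_iff)
  have conth': "isCont h' t" if "0 < t" "t < 1" for t
    using that unfolding h'_def by (auto intro!: continuous_intros)
  have lim0: "((ereal \<circ> h \<circ> real_of_ereal) \<longlongrightarrow> 0) (at_right 0)"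
  proof -
    have "(h \<longlongrightarrow> h 0) (at_right 0)"
      unfolding h_def by (intro tendsto_intros) auto
    thus ?thesis unfolding zero_ereal_def
      by (subst ereal_tendsto_simps1) (simp add: o_def h_def zero_ereal_def)
  qed
  have lim1: "((ereal \<circ> h \<circ> real_of_ereal) \<longlongrightarrow> \<infinity>) (at_left 1)"
  proof -
    have "filterlim (\<lambda>t::real. t / (1 - t)) at_top (at_left 1)"
      by real_asymp
    hence "filterlim h at_top (at_left 1)"
      unfolding h_def by (intro filterlim_compose[OF sqrt_at_top])
    thus ?thesis unfolding one_ereal_def
      by (subst ereal_tendsto_simps1) (simp add: o_def tendsto_PInfty_eq_at_top)
  qed
  have "set_integrable lborel {0<..<1} (\<lambda>t. f (h t) * h' t) \<longleftrightarrow> set_integrable lborel {0<..<1} (\<lambda>t. b t / 2)"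
    by (intro set_integrable_cong) (auto simp: fh)
  hence int_fh: "set_integrable lborel (einterval 0 1) (\<lambda>t. f (h t) * h' t)"
    unfolding einterval using int_b by simp
  have nonneg: "f x \<ge> 0" "h' x \<ge> 0" for x by (simp_all add: f_def h'_def)
  \<comment> \<open>For a nonnegative integrand the substitution transfers integrability as well as
    the value, so convergence at infinity is inherited from the Beta integral.\<close>
  have *: "set_integrable lborel (einterval 0 \<infinity>) f"
    by (rule interval_integral_substitution_nonneg(1)[where g = h and g' = h' and a = 0 and b = 1])
       (simp_all add: h' contf conth' nonneg lim0 lim1 int_fh)
  have **: "interval_lebesgue_integral lborel 0 \<infinity> f =
              interval_lebesgue_integral lborel 0 1 (\<lambda>t. f (h t) * h' t)"
    by (rule interval_integral_substitution_nonneg(2)[where g = h and g' = h' and a = 0 and b = 1])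
       (simp_all add: h' contf conth' nonneg lim0 lim1 int_fh)
  show "set_integrable lborel {0<..} (\<lambda>x. (1 + x\<^sup>2) powr (- \<sigma>))"
    using * by (simp add: einterval f_def)
  have "(LINT x:{0<..}|lborel. f x) = (LINT t:{0<..<1}|lborel. f (h t) * h' t)"
    using ** by (simp add: interval_lebesgue_integral_def einterval)
  also have "\<dots> = (LINT t:{0<..<1}|lborel. b t / 2)"
    by (intro set_lebesgue_integral_cong) (auto simp: fh)
  finally show "(LINT x:{0<..}|lborel. (1 + x\<^sup>2) powr (- \<sigma>)) = Beta (1/2) (\<sigma> - 1/2) / 2"
    using val_b by (simp add: f_def)
qed

lemma line_integral_powr_real:
  fixes \<sigma> :: real
  assumes "\<sigma> > 1/2"
  shows   "integrable lborel (\<lambda>x. (1 + x\<^sup>2) powr (- \<sigma>))"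
    and   "(LINT x|lborel. (1 + x\<^sup>2) powr (- \<sigma>)) = Beta (1/2) (\<sigma> - 1/2)"
proof -
  define f where "f = (\<lambda>x::real. (1 + x\<^sup>2) powr (- \<sigma>))"
  have even: "f (- x) = f x" for x by (simp add: f_def)
  define g where "g = (\<lambda>x. indicator {0<..} x *\<^sub>R f x)"
  have g: "integrable lborel g" "(LINT x|lborel. g x) = Beta (1/2) (\<sigma> - 1/2) / 2"
    using half_line_integral_powr[OF assms]
    by (simp_all add: set_integrable_def set_lebesgue_integral_def f_def g_def)
  have g': "integrable lborel (\<lambda>x. g (- x))" "(LINT x|lborel. g (- x)) = Beta (1/2) (\<sigma> - 1/2) / 2"
    using lborel_integrable_real_affine[OF g(1), of "-1" 0]
          lborel_integral_real_affine[of "-1" g 0] g by simp_all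
  \<comment> \<open>The equality fails at 0, where the left side is 0 and \<open>f 0\<close> is 1; a
    single point is negligible.\<close>
  have AE: "AE x in lborel. g x + g (- x) = f x"
    using AE_lborel_singleton[of 0] by eventually_elim (auto simp: g_def even indicator_def)
  have f_meas: "f \<in> borel_measurable lborel" by (simp add: f_def)
  have *: "integrable lborel (\<lambda>x. g x + g (- x))" using g g' by (intro Bochner_Integration.integrable_add)
  show "integrable lborel (\<lambda>x. (1 + x\<^sup>2) powr (- \<sigma>))"
    using integrable_cong_AE[OF _ f_meas AE] * by (simp add: f_def[symmetric])
  have "(LINT x|lborel. f x) = (LINT x|lborel. g x + g (- x))"
    using AE * f_meas by (intro integral_cong_AE) auto
  also have "\<dots> = Beta (1/2) (\<sigma> - 1/2)"
    using g g' by (subst Bochner_Integration.integral_add) auto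
  finally show "(LINT x|lborel. (1 + x\<^sup>2) powr (- \<sigma>)) = Beta (1/2) (\<sigma> - 1/2)"
    by (simp add: f_def)
qed

definition line_integral :: "complex \<Rightarrow> complex" where
  "line_integral s = (LINT x|lborel. of_real (1 + x\<^sup>2) powr (- s))"

lemma integrable_line_integral:
  assumes "Re s > 1/2"
  shows   "integrable lborel (\<lambda>x::real. of_real (1 + x\<^sup>2) powr (- s) :: complex)"
proof (rule Bochner_Integration.integrable_bound)
  show "integrable lborel (\<lambda>x::real. (1 + x\<^sup>2) powr (- Re s))"
    using assms by (rule line_integral_powr_real)
  have "continuous_on UNIV (\<lambda>x::real. of_real (1 + x\<^sup>2) powr (- s) :: complex)"
    by (intro continuous_on_of_real_powr continuous_intros) (simp add: add_pos_nonneg)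
  thus "(\<lambda>x::real. of_real (1 + x\<^sup>2) powr (- s) :: complex) \<in> borel_measurable lborel"
    by (simp add: borel_measurable_continuous_onI)
  have "norm (of_real (1 + x\<^sup>2) powr (- s) :: complex) = (1 + x\<^sup>2) powr (- Re s)" for x :: real
    by (subst norm_of_real_powr) auto
  thus "AE x in lborel. norm (of_real (1 + x\<^sup>2) powr (- s) :: complex) \<le> norm ((1 + x\<^sup>2) powr (- Re s))"
    by simp
qed

lemma line_integral_of_real:
  assumes "\<sigma> > 1/2"
  shows   "line_integral (of_real \<sigma>) = Beta (1/2) (of_real \<sigma> - 1/2)"
proof -
  have "(of_real (1 + x\<^sup>2) powr (- of_real \<sigma>) :: complex) = of_real ((1 + x\<^sup>2) powr (- \<sigma>))" for x :: real
    using powr_of_real[of "1 + x\<^sup>2" "-\<sigma>"] by simp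
  hence "line_integral (of_real \<sigma>) = of_real (LINT x|lborel. (1 + x\<^sup>2) powr (- \<sigma>))"
    unfolding line_integral_def by (simp only: integral_complex_of_real)
  also have "\<dots> = of_real (Beta (1/2) (\<sigma> - 1/2))"
    using assms by (simp only: line_integral_powr_real)
  also have "\<dots> = Beta (1/2) (of_real \<sigma> - 1/2)"
    using Beta_complex_of_real[of "1/2" "\<sigma> - 1/2"] by simp
  finally show ?thesis .
qed

lemma norm_form_affine:
  "norm_form \<tau> m (- of_int m * Re \<tau> + of_int m * Im \<tau> * y) = (of_int m * Im \<tau>)\<^sup>2 * (1 + y\<^sup>2)"
  unfolding norm_form_altdef by algebra

lemma of_real_square_powr:
  assumes "c > 0"
  shows   "(of_real (c\<^sup>2) :: complex) powr s = of_real c powr (2 * s)"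
proof -
  have "ln (c\<^sup>2) = 2 * ln c" using assms by (simp add: ln_realpow)
  thus ?thesis using assms by (simp add: of_real_powr_eq_exp mult_ac del: of_real_power)
qed

lemma of_real_mult_powr:
  assumes "x \<ge> 0" "y \<ge> 0"
  shows   "(of_real (x * y) :: complex) powr s = of_real x powr s * of_real y powr s"
  using powr_times_real[of "of_real x" "of_real y" s] assms by simp

text \<open>Completing the square: with c = m Im \<tau>, the substitution x = -m Re \<tau> + c y
  turns the norm form into c^2 (1 + y^2). The power contributes c^(-2s) and dx contributes
  c.\<close>

lemma integral_norm_form_powr:
  assumes "Im \<tau> > 0" "m > 0" "Re s > 1/2"
  shows   "integrable lborel (\<lambda>x. of_real (norm_form \<tau> m x) powr (- s) :: complex)" (is ?th1)
    and   "(LINT x|lborel. of_real (norm_form \<tau> m x) powr (- s)) =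
             of_real (of_int m * Im \<tau>) powr (1 - 2 * s) * line_integral s" (is ?th2)
proof -
  define c where "c = of_int m * Im \<tau>"
  have c: "c > 0" using assms by (simp add: c_def)
  define f where "f = (\<lambda>x. of_real (norm_form \<tau> m x) powr (- s) :: complex)"
  have f: "f (- of_int m * Re \<tau> + c * y) = of_real c powr (- 2 * s) * of_real (1 + y\<^sup>2) powr (- s)" for y
  proof -
    have "f (- of_int m * Re \<tau> + c * y) = of_real (c\<^sup>2 * (1 + y\<^sup>2)) powr (- s)"
      by (simp only: f_def c_def norm_form_affine)
    also have "\<dots> = of_real (c\<^sup>2) powr (- s) * of_real (1 + y\<^sup>2) powr (- s)"
      by (rule of_real_mult_powr) auto
    also have "of_real (c\<^sup>2) powr (- s) = (of_real c powr (- 2 * s) :: complex)"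
      using of_real_square_powr[OF c, of "- s"] by simp
    finally show ?thesis .
  qed
  have "integrable lborel (\<lambda>y. f (- of_int m * Re \<tau> + c * y))"
    unfolding f using integrable_line_integral[OF assms(3)] by (intro integrable_mult_right)
  thus ?th1 using c lborel_integrable_real_affine_iff[of c f "- of_int m * Re \<tau>"]
    by (simp add: f_def)
  have "(LINT x|lborel. f x) = \<bar>c\<bar> *\<^sub>R (LINT y|lborel. f (- of_int m * Re \<tau> + c * y))"
    using c by (intro lborel_integral_real_affine) auto
  also have "\<dots> = of_real c * (of_real c powr (- 2 * s) * line_integral s)"
    unfolding f using c by (simp add: line_integral_def scaleR_conv_of_real)
  also have "\<dots> = of_real c powr (1 - 2 * s) * line_integral s"
    using c powr_add[of "of_real c :: complex" 1 "- 2 * s"] by simp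
  finally show ?th2 by (simp add: f_def c_def)
qed

lemma has_sum_integral_norm_form:
  assumes "Im \<tau> > 0" "m > 0" "Re s > 1/2"
  shows   "((\<lambda>n::int. integral {of_int n..of_int n + 1} (\<lambda>x. of_real (norm_form \<tau> m x) powr (- s)))
              has_sum of_real (of_int m * Im \<tau>) powr (1 - 2 * s) * line_integral s) UNIV"
  using has_sum_integral_unit_intervals[OF integral_norm_form_powr(1)[OF assms]]
  unfolding integral_norm_form_powr(2)[OF assms] .

text \<open>The improper integral is cut at the integers, which reduces holomorphy to integrals over
  compact intervals and a summable majorant. Since 1 + x^2 is the norm form for \<tau> = \<i> and m
  = 1, the lattice bounds apply.\<close>

lemma holomorphic_line_integral: "line_integral holomorphic_on {s. Re s > 1}"
proof -
  have nf: "norm_form \<i> 1 x = 1 + x\<^sup>2" for x by (simp add: norm_form_altdef)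
  have "(\<lambda>s. \<Sum>\<^sub>\<infinity>n\<in>(UNIV :: int set). integral {of_int n..of_int n + 1}
          (\<lambda>x. of_real (norm_form \<i> 1 x) powr (- s))) holomorphic_on {s. Re s > 1}"
  proof (rule holomorphic_on_infsum)
    fix z assume z: "z \<in> {s. Re s > 1}"
    then obtain r where r: "r > 0"
       "\<And>w. w \<in> cball z r \<Longrightarrow> Re w \<ge> (Re z + 1) / 2 \<and> norm w \<le> norm z + r"
      using cball_Re_bounds[of 1 z] by (metis mem_Collect_eq)
    define \<sigma> where "\<sigma> = (Re z + 1) / 2"
    have \<sigma>: "\<sigma> > 1" using z by (simp add: \<sigma>_def)
    have *: "Re w \<ge> \<sigma>" "norm w \<le> norm z + r" if "w \<in> cball z r" for w
      using r(2)[OF that] by (auto simp: \<sigma>_def)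
    obtain B where B: "\<And>m n s x. m > 0 \<Longrightarrow> \<sigma> \<le> Re s \<Longrightarrow> norm s \<le> norm z + r \<Longrightarrow>
       x \<in> {of_int n..of_int n + 1} \<Longrightarrow>
       norm (of_real (norm_form \<i> m x) powr (- s)) \<le> B * lattice_weight (m, n) powr (- \<sigma>)"
      by (rule lattice_term_bound[of \<i> \<sigma> "norm z + r"]) (use \<sigma> in auto)
    show "\<exists>r M. r > 0 \<and> cball z r \<subseteq> {s. Re s > 1} \<and> M summable_on UNIV \<and>
            (\<forall>n\<in>UNIV. \<forall>w\<in>cball z r. norm (integral {of_int n..of_int n + 1}
               (\<lambda>x. of_real (norm_form \<i> 1 x) powr (- w))) \<le> M n)"
    proof (intro exI[of _ r] exI[of _ "\<lambda>n. B * max 1 \<bar>of_int n\<bar> powr (- \<sigma>)"] conjI ballI)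
      show "cball z r \<subseteq> {s. Re s > 1}"
        using * \<sigma> by fastforce
      show "(\<lambda>n. B * max 1 \<bar>of_int n\<bar> powr (- \<sigma>)) summable_on UNIV"
        using \<sigma> by (intro summable_on_cmult_right summable_on_powr_int) auto
      fix n :: int and w assume w: "w \<in> cball z r"
      have "norm (integral {of_int n..of_int n + 1} (\<lambda>x. of_real (norm_form \<i> 1 x) powr (- w)))
              \<le> B * lattice_weight (1, n) powr (- \<sigma>) * (of_int n + 1 - of_int n)"
        by (intro integral_bound continuous_on_of_real_powr continuous_on_norm_form norm_form_pos B *[OF w]) auto
      thus "norm (integral {of_int n..of_int n + 1} (\<lambda>x. of_real (norm_form \<i> 1 x) powr (- w)))
              \<le> B * max 1 \<bar>of_int n\<bar> powr (- \<sigma>)" by simp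
    qed (use r(1) in auto)
  next
    fix n :: int
    show "(\<lambda>s. integral {of_int n..of_int n + 1} (\<lambda>x. of_real (norm_form \<i> 1 x) powr (- s)))
            holomorphic_on {s. Re s > 1}"
      by (intro holomorphic_on_integral_powr continuous_on_norm_form norm_form_pos) auto
  qed (rule open_halfspace_Re_gt)
  thus ?thesis
  proof (rule holomorphic_transform)
    fix s assume s: "s \<in> {s. Re s > 1}"
    have "((\<lambda>n::int. integral {of_int n..of_int n + 1} (\<lambda>x. of_real (norm_form \<i> 1 x) powr (- s)))
              has_sum line_integral s) UNIV"
      using has_sum_integral_norm_form[of \<i> 1 s] s by simp
    thus "(\<Sum>\<^sub>\<infinity>n\<in>(UNIV :: int set). integral {of_int n..of_int n + 1}
          (\<lambda>x. of_real (norm_form \<i> 1 x) powr (- s))) = line_integral s"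
      by (rule infsumI)
  qed
qed

text \<open>The Beta integral is available for real exponents only; the identity theorem does the rest.\<close>

lemma line_integral_eq_Beta:
  assumes "Re s > 1"
  shows   "line_integral s = Beta (1/2) (s - 1/2)"
proof -
  have "line_integral s - Beta (1/2) (s - 1/2) = 0"
  proof (rule analytic_continuation[where f = "\<lambda>s. line_integral s - Beta (1/2) (s - 1/2)" and
           S = "{s. Re s > 1}" and U = "of_real ` {1<..}" and \<xi> = 2])
    have "s - 1/2 \<notin> \<int>\<^sub>\<le>\<^sub>0" if "Re s > 1" for s :: complex
      using that by (auto elim!: nonpos_Ints_cases dest!: arg_cong[of _ _ Re])
    moreover have "(1/2 :: complex) \<notin> \<int>\<^sub>\<le>\<^sub>0"
      by (auto elim!: nonpos_Ints_cases simp: complex_eq_iff)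
    ultimately show "(\<lambda>s. line_integral s - Beta (1/2) (s - 1/2)) holomorphic_on {s. Re s > 1}"
      by (intro holomorphic_intros holomorphic_line_integral) auto
    show "connected {s. Re s > 1}"
      by (intro convex_connected convex_halfspace_Re_gt)
    have "(2 :: real) islimpt {1<..}"
      by (intro interior_limit_point) (simp add: interior_open)
    hence "complex_of_real 2 islimpt of_real ` {1<..}"
      by (rule islimpt_isCont_image) (simp, simp only: eventually_at_filter of_real_eq_iff, simp)
    thus "(2 :: complex) islimpt of_real ` {1<..}" by simp
    show "open {s. Re s > 1}" by (rule open_halfspace_Re_gt)
    show "s \<in> {s. Re s > 1}" using assms by simp
    fix z :: complex assume "z \<in> of_real ` {1<..}"
    then obtain \<sigma> where "z = of_real \<sigma>" "\<sigma> > 1" by auto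
    thus "line_integral z - Beta (1/2) (z - 1/2) = 0"
      by (simp only: line_integral_of_real diff_self)
  qed auto
  thus ?thesis by simp
qed

subsection \<open>The Eisenstein series on its half-plane of convergence\<close>

lemma has_sum_lattice:
  assumes tau: "Im \<tau> > 0" and s: "Re s > 1"
  shows   "((\<lambda>(m, n). of_real (norm_form \<tau> m (of_int n)) powr (- s)) has_sum
              lattice_gap \<tau> s + of_real (Im \<tau>) powr (1 - 2 * s) * Beta (1/2) (s - 1/2) *
                riemann_zeta (2 * s - 1)) ({0<..} \<times> UNIV)"
proof -
  define f where "f = (\<lambda>x. of_real (norm_form \<tau> (fst x) (of_int (snd x))) powr (- s))"
  define g where "g = (\<lambda>x. powr_gap (norm_form \<tau> (fst x)) (of_int (snd x)) s)"
  define I where "I = (\<lambda>x. integral {of_int (snd x)..of_int (snd x) + 1}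
                         (\<lambda>t. of_real (norm_form \<tau> (fst x) t) powr (- s)))"
  have fgI: "f x = g x + I x" for x
    by (simp add: f_def g_def I_def powr_gap_def)
  have f: "f summable_on {0<..} \<times> UNIV"
    using lattice_term_summable[OF tau s] by (simp add: f_def case_prod_unfold)
  have g: "g summable_on {0<..} \<times> UNIV"
    using lattice_gap_summable[OF tau, of s] s by (simp add: g_def case_prod_unfold)
  \<comment> \<open>The double family of integrals is summable as a difference of two summable
    families; this is what allows its sum to be computed row by row below.\<close>
  have "(\<lambda>x. f x + (-1) * g x) summable_on {0<..} \<times> UNIV"
    by (intro summable_on_add summable_on_cmult_right f g)
  hence I: "I summable_on {0<..} \<times> UNIV"
    by (simp add: fgI)
  have "(I has_sum (of_real (Im \<tau>) powr (1 - 2 * s) * line_integral s * riemann_zeta (2 * s - 1)))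
          ({0<..} \<times> UNIV)"
  proof (rule has_sum_SigmaI[OF _ _ I])
    show "((\<lambda>n. I (m, n)) has_sum of_real (of_int m * Im \<tau>) powr (1 - 2 * s) * line_integral s) UNIV"
      if "m \<in> {0<..}" for m
      using has_sum_integral_norm_form[of \<tau> m s] that tau s by (simp add: I_def)
    have "((\<lambda>m::int. of_real (Im \<tau>) powr (1 - 2 * s) * line_integral s *
            of_real (of_int m) powr (- (2 * s - 1))) has_sum
           of_real (Im \<tau>) powr (1 - 2 * s) * line_integral s * riemann_zeta (2 * s - 1)) {0<..}"
      using s by (intro has_sum_cmult_right has_sum_riemann_zeta) auto
    thus "((\<lambda>m::int. of_real (of_int m * Im \<tau>) powr (1 - 2 * s) * line_integral s) has_sum
           of_real (Im \<tau>) powr (1 - 2 * s) * line_integral s * riemann_zeta (2 * s - 1)) {0<..}"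
    proof (rule has_sum_cong[THEN iffD1, rotated])
      fix m :: int assume "m \<in> {0<..}"
      thus "of_real (Im \<tau>) powr (1 - 2 * s) * line_integral s * of_real (of_int m) powr (- (2 * s - 1)) =
              of_real (of_int m * Im \<tau>) powr (1 - 2 * s) * line_integral s"
        using tau by (subst of_real_mult_powr) auto
    qed
  qed
  moreover have "(g has_sum lattice_gap \<tau> s) ({0<..} \<times> UNIV)"
    using g by (simp add: lattice_gap_def g_def case_prod_unfold)
  ultimately have "((\<lambda>x. g x + I x) has_sum (lattice_gap \<tau> s + of_real (Im \<tau>) powr (1 - 2 * s) * line_integral s *
                      riemann_zeta (2 * s - 1))) ({0<..} \<times> UNIV)"
    by (intro has_sum_add)
  thus ?thesis
    using s by (simp add: fgI[symmetric] line_integral_eq_Beta) (simp add: f_def case_prod_unfold)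
qed

text \<open>The row m = 0 consists of the powers n^(-2s) with n > 0 and adds zeta(2s) to the rows
  with m > 0.\<close>

lemma has_sum_half_lattice:
  assumes tau: "Im \<tau> > 0" and s: "Re s > 1"
  shows   "((\<lambda>(m, n). of_real (norm_form \<tau> m (of_int n)) powr (- s)) has_sum
              riemann_zeta (2 * s) + (lattice_gap \<tau> s + of_real (Im \<tau>) powr (1 - 2 * s) *
                Beta (1/2) (s - 1/2) * riemann_zeta (2 * s - 1))) half_lattice"
proof -
  define f :: "int \<times> int \<Rightarrow> complex" where "f = (\<lambda>(m, n). of_real (norm_form \<tau> m (of_int n)) powr (- s))"
  have "((\<lambda>n::int. of_real (of_int n) powr (- (2 * s))) has_sum riemann_zeta (2 * s)) {0<..}"
    using s by (intro has_sum_riemann_zeta) auto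
  hence "((\<lambda>n. f (0, n)) has_sum riemann_zeta (2 * s)) {0<..}"
  proof (rule has_sum_cong[THEN iffD1, rotated])
    fix n :: int assume "n \<in> {0<..}"
    thus "of_real (of_int n) powr (- (2 * s)) = f (0, n)"
      using of_real_square_powr[of "of_int n" "- s"] by (simp add: f_def norm_form_altdef)
  qed
  moreover have "bij_betw (Pair (0 :: int)) {0<..} ({0} \<times> {0<..} :: (int \<times> int) set)"
    by (auto simp: bij_betw_def inj_on_def)
  ultimately have "(f has_sum riemann_zeta (2 * s)) ({0} \<times> {0<..})"
    using has_sum_reindex_bij_betw[of "Pair 0" "{0<..}" "{0} \<times> {0<..}" f] by metis
  moreover have "{0} \<times> {0<..} \<inter> {0<..} \<times> UNIV = ({} :: (int \<times> int) set)"
    by auto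
  ultimately have "(f has_sum riemann_zeta (2 * s) + (lattice_gap \<tau> s + of_real (Im \<tau>) powr (1 - 2 * s) *
                Beta (1/2) (s - 1/2) * riemann_zeta (2 * s - 1))) ({0} \<times> {0<..} \<union> {0<..} \<times> UNIV)"
    using has_sum_lattice[OF assms, folded f_def] by (intro has_sum_Un_disjoint)
  moreover have "half_lattice = {0} \<times> {0<..} \<union> {0<..} \<times> UNIV"
    by (auto simp: half_lattice_def)
  ultimately show ?thesis
    unfolding f_def [symmetric] by simp
qed

lemma norm_form_mult: "norm_form \<tau> (k * m) (of_int k * x) = (of_int k)\<^sup>2 * norm_form \<tau> m x"
  unfolding norm_form_altdef of_int_mult by algebra

lemma eisenstein_series_times_zeta:
  assumes tau: "Im \<tau> > 0" and s: "Re s > 1"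
  shows   "riemann_zeta (2 * s) * eisenstein_series \<tau> s = of_real (Im \<tau>) powr s *
             (riemann_zeta (2 * s) + (lattice_gap \<tau> s + of_real (Im \<tau>) powr (1 - 2 * s) *
                Beta (1/2) (s - 1/2) * riemann_zeta (2 * s - 1)))"
    (is "_ = _ * ?S")
proof -
  define f :: "int \<times> int \<Rightarrow> complex" where "f = (\<lambda>(m, n). of_real (norm_form \<tau> m (of_int n)) powr (- s))"
  have nf: "norm_form \<tau> c (of_int d) > 0" if "(c, d) \<in> primitive_pairs" for c d
    using that tau by (intro norm_form_pos) (auto simp: primitive_pairs_def half_lattice_def)
  have "(f has_sum ?S) half_lattice"
    unfolding f_def by (rule has_sum_half_lattice[OF assms])
  hence "((\<lambda>x. f (case x of (k, c, d) \<Rightarrow> (k * c, k * d))) has_sum ?S) ({0<..} \<times> primitive_pairs)"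
    by (subst has_sum_reindex_bij_betw[OF bij_betw_half_lattice])
  also have "?this \<longleftrightarrow> ((\<lambda>(k, x). of_real (of_int k) powr (- (2 * s)) * f x) has_sum ?S)
               ({0<..} \<times> primitive_pairs)"
  proof (rule has_sum_cong)
    fix y :: "int \<times> int \<times> int" assume "y \<in> {0<..} \<times> primitive_pairs"
    then obtain k c d where [simp]: "y = (k, c, d)" and k: "k > 0" and cd: "(c, d) \<in> primitive_pairs"
      by auto
    have "norm_form \<tau> (k * c) (of_int (k * d)) = (of_int k)\<^sup>2 * norm_form \<tau> c (of_int d)"
      using norm_form_mult[of \<tau> k c "of_int d"] by simp
    thus "f (case y of (k, c, d) \<Rightarrow> (k * c, k * d)) =
            (case y of (k, x) \<Rightarrow> of_real (of_int k) powr (- (2 * s)) * f x)"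
      using k nf[OF cd] of_real_square_powr[of "of_int k" "- s"]
            of_real_mult_powr[of "(of_int k)\<^sup>2" "norm_form \<tau> c (of_int d)" "- s"]
      by (simp add: f_def)
  qed
  finally have S: "((\<lambda>(k, x). of_real (of_int k) powr (- (2 * s)) * f x) has_sum ?S)
                     ({0<..} \<times> primitive_pairs)" .
  \<comment> \<open>The slice k = 1 of the sum over multiples and primitive pairs; it gives
    summability over the primitive pairs alone.\<close>
  have "(\<lambda>x. of_real (of_int 1) powr (- (2 * s)) * f x) summable_on primitive_pairs"
    by (rule summable_on_SigmaD1) (use S in \<open>auto simp: summable_on_def\<close>)
  then obtain T where T: "(f has_sum T) primitive_pairs"
    by (auto simp: summable_on_def)
  have "((\<lambda>k::int. of_real (of_int k) powr (- (2 * s)) * T) has_sum ?S) {0<..}"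
    by (rule has_sum_SigmaD[OF S]) (use T in \<open>auto intro!: has_sum_cmult_right\<close>)
  moreover have "((\<lambda>k::int. of_real (of_int k) powr (- (2 * s)) * T) has_sum riemann_zeta (2 * s) * T) {0<..}"
    using s by (intro has_sum_cmult_left has_sum_riemann_zeta) auto
  ultimately have ST: "?S = riemann_zeta (2 * s) * T" by (rule has_sum_unique)
  have "((\<lambda>x. of_real (Im \<tau>) powr s * f x) has_sum of_real (Im \<tau>) powr s * T) primitive_pairs"
    by (intro has_sum_cmult_right T)
  also have "?this \<longleftrightarrow> ((\<lambda>(c, d). of_real (Im \<tau> / norm_form \<tau> c (of_int d)) powr s) has_sum
               of_real (Im \<tau>) powr s * T) primitive_pairs"
  proof (rule has_sum_cong, clarify)
    fix c d assume "(c, d) \<in> primitive_pairs"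
    from nf[OF this] show "of_real (Im \<tau>) powr s * f (c, d) =
        (of_real (Im \<tau> / norm_form \<tau> c (of_int d)) :: complex) powr s"
      using tau by (simp add: f_def of_real_powr_eq_exp ln_div ring_distribs exp_minus exp_diff field_simps
                         del: of_real_divide)
  qed
  finally have E: "eisenstein_series \<tau> s = of_real (Im \<tau>) powr s * T"
    unfolding eisenstein_series_altdef by (rule infsumI)
  have "riemann_zeta (2 * s) * eisenstein_series \<tau> s = of_real (Im \<tau>) powr s * (riemann_zeta (2 * s) * T)"
    unfolding E by (rule mult.left_commute)
  thus ?thesis by (simp only: ST[symmetric])
qed

subsection \<open>The value at 1\<close>

text \<open>Logarithmic derivative of the reflection formula: both sides of Gamma(z) Gamma(1 - z) =
  pi / sin(pi z) are differentiated, and the common nonzero factor pi / sin(pi z) is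
  cancelled.\<close>

lemma Digamma_reflection:
  fixes z :: complex
  assumes "z \<notin> \<int>"
  shows   "Digamma z - Digamma (1 - z) = - of_real pi * cot (of_real pi * z)"
proof -
  have nonint: "z \<notin> \<int>\<^sub>\<le>\<^sub>0" "1 - z \<notin> \<int>\<^sub>\<le>\<^sub>0"
  proof -
    show "z \<notin> \<int>\<^sub>\<le>\<^sub>0" using assms nonpos_Ints_subset_Ints by blast
    have "1 - (1 - z) \<in> \<int>" if "1 - z \<in> \<int>" using that by (rule Ints_diff[OF Ints_1])
    thus "1 - z \<notin> \<int>\<^sub>\<le>\<^sub>0" using assms nonpos_Ints_subset_Ints by auto
  qed
  have sin: "sin (of_real pi * z) \<noteq> 0"
  proof
    assume "sin (of_real pi * z) = 0"
    then obtain n :: int where "of_real pi * z = of_real pi * of_int n"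
      by (auto simp: Complex_Transcendental.sin_eq_0 mult_ac)
    hence "z = of_int n" by (subst (asm) mult_cancel_left) simp
    thus False using assms by simp
  qed
  have "((\<lambda>z. Gamma z * Gamma (1 - z)) has_field_derivative
          Gamma z * Gamma (1 - z) * (Digamma z - Digamma (1 - z))) (at z)"
    using nonint by (auto intro!: derivative_eq_intros simp: algebra_simps)
  moreover have "((\<lambda>z. of_real pi / sin (of_real pi * z)) has_field_derivative
          - of_real pi * (of_real pi * cos (of_real pi * z)) / (sin (of_real pi * z))\<^sup>2) (at z)"
    using sin by (auto intro!: derivative_eq_intros simp: power2_eq_square)
  ultimately have "Gamma z * Gamma (1 - z) * (Digamma z - Digamma (1 - z)) =
                     - of_real pi * (of_real pi * cos (of_real pi * z)) / (sin (of_real pi * z))\<^sup>2"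
    unfolding Gamma_reflection_complex by (rule DERIV_unique)
  hence "of_real pi / sin (of_real pi * z) * (Digamma z - Digamma (1 - z)) =
           of_real pi / sin (of_real pi * z) * (- of_real pi * cot (of_real pi * z))"
    unfolding Gamma_reflection_complex by (simp add: cot_def power2_eq_square)
  thus ?thesis using sin by (subst (asm) mult_cancel_left) simp
qed

lemma cot_eq_exp:
  assumes "Im z > 0"
  defines "e \<equiv> exp (2 * of_real pi * \<i> * z)"
  shows   "cot (of_real pi * z) = - \<i> * (1 + e) / (1 - e)"
proof -
  define y where "y = exp (\<i> * (of_real pi * z))"
  have y: "y \<noteq> 0" by (simp add: y_def)
  have e: "e = y\<^sup>2" by (simp add: e_def y_def exp_double[symmetric] mult_ac)
  have "norm e < 1" using assms by (simp add: e_def)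
  hence e1: "y\<^sup>2 \<noteq> 1" unfolding e by auto
  have s: "sin (of_real pi * z) = (y - 1 / y) / (2 * \<i>)" "cos (of_real pi * z) = (y + 1 / y) / 2"
    by (simp_all add: sin_exp_eq cos_exp_eq y_def exp_minus inverse_eq_divide)
  show ?thesis unfolding cot_def s e using y e1
    by (simp add: divide_simps power2_eq_square) (simp add: algebra_simps)
qed

text \<open>Partial fractions: 1/((z+k)(w+k)) is (1/(w+k) - 1/(z+k)) / (z - w), a difference of
  terms of two Digamma series, in which the terms 1/(k+1) and Euler's constant cancel.\<close>

lemma sums_shifted_product:
  fixes z w :: complex
  assumes "z \<noteq> 0" "w \<noteq> 0" "z \<noteq> w" and nz: "\<And>k. z + of_nat k \<noteq> 0" "\<And>k. w + of_nat k \<noteq> 0"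
  shows   "(\<lambda>k. 1 / ((z + of_nat k) * (w + of_nat k))) sums ((Digamma z - Digamma w) / (z - w))"
proof -
  have *: "(\<lambda>k. inverse (of_nat (Suc k)) - inverse (x + of_nat k)) sums (Digamma x + euler_mascheroni)"
    if "x \<noteq> 0" for x :: complex
    using summable_sums[OF summable_Digamma[OF that]] by (simp add: Digamma_def)
  have "(\<lambda>k. ((inverse (of_nat (Suc k)) - inverse (z + of_nat k)) -
              (inverse (of_nat (Suc k)) - inverse (w + of_nat k))) / (z - w)) sums
          (((Digamma z + euler_mascheroni) - (Digamma w + euler_mascheroni)) / (z - w))"
    by (intro sums_divide sums_diff * assms)
  also have "(\<lambda>k. ((inverse (of_nat (Suc k)) - inverse (z + of_nat k)) -
              (inverse (of_nat (Suc k)) - inverse (w + of_nat k))) / (z - w)) =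
             (\<lambda>k. 1 / ((z + of_nat k) * (w + of_nat k)))"
  proof
    fix k
    show "((inverse (of_nat (Suc k)) - inverse (z + of_nat k)) -
            (inverse (of_nat (Suc k)) - inverse (w + of_nat k))) / (z - w) =
          1 / ((z + of_nat k) * (w + of_nat k))"
    proof -
      have "(inverse (of_nat (Suc k)) - inverse (z + of_nat k)) -
            (inverse (of_nat (Suc k)) - inverse (w + of_nat k)) =
              inverse (w + of_nat k) - inverse (z + of_nat k)" by simp
      also have "\<dots> = (z - w) / ((z + of_nat k) * (w + of_nat k))"
        using nz[of k] by (simp add: field_simps)
      finally show ?thesis using assms(3) by simp
    qed
  qed
  finally show ?thesis by simp
qed

text \<open>With z = m \<tau> the norm form factors as (z + n)(cnj z + n). The halves n \<ge> 0 and
  n < 0 are Digamma differences at z and at 1 - z, and the reflection formula merges them into a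
  cotangent.\<close>

lemma sum_inverse_norm_form:
  fixes S :: complex
  assumes tau: "Im \<tau> > 0" and m: "m > 0"
  assumes S: "((\<lambda>n. of_real (norm_form \<tau> m (of_int n)) powr (- 1)) has_sum S) UNIV"
  defines "e \<equiv> exp (2 * of_real pi * \<i> * (of_int m * \<tau>))"
  shows   "S = of_real (pi / (of_int m * Im \<tau>) * Re ((1 + e) / (1 - e)))"
proof -
  define f :: "int \<Rightarrow> complex" where "f = (\<lambda>n. of_real (norm_form \<tau> m (of_int n)) powr (- 1))"
  define z where "z = of_int m * \<tau>"
  have Im_z: "Im z > 0" using tau m by (simp add: z_def)
  have nonint: "x \<notin> \<int>" "x \<noteq> of_int k" "x + of_nat k' \<noteq> 0" if "Im x \<noteq> 0" for x k k'
    using that by (auto simp: Ints_def complex_eq_iff)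
  have f: "f n = 1 / ((z + of_int n) * (cnj z + of_int n))" for n
  proof -
    have "f n = inverse (of_real (norm_form \<tau> m (of_int n)))"
      using norm_form_pos[OF tau, of m "of_int n"] m by (simp add: f_def powr_minus)
    also have "of_real (norm_form \<tau> m (of_int n)) = (z + of_int n) * cnj (z + of_int n)"
      by (simp only: complex_norm_square[symmetric] norm_form_def z_def of_real_of_int_eq)
    finally show ?thesis by (simp add: inverse_eq_divide)
  qed
  have f_sum: "f summable_on UNIV" using S by (auto simp: summable_on_def f_def)
  define A where "A = infsum f {0..}"
  define B where "B = infsum f {..<0}"
  have A: "(f has_sum A) {0..}" unfolding A_def
    by (rule has_sum_infsum, rule summable_on_subset_banach[OF f_sum]) simp
  have B: "(f has_sum B) {..<0}" unfolding B_def
    by (rule has_sum_infsum, rule summable_on_subset_banach[OF f_sum]) simp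
  have "(f has_sum (A + B)) ({0..} \<union> {..<0})"
    by (intro has_sum_Un_disjoint A B) auto
  also have "{0..} \<union> {..<0} = (UNIV :: int set)" by auto
  finally have SAB: "S = A + B" using S unfolding f_def [symmetric] by (metis has_sum_unique)
  have "bij_betw int UNIV {0..}"
    by (rule bij_betwI[where g = nat]) auto
  hence "((\<lambda>k. f (int k)) has_sum A) UNIV"
    using A has_sum_reindex_bij_betw[of int UNIV "{0..}" f A] by simp
  hence "(\<lambda>k. f (int k)) sums A" by (rule has_sum_imp_sums)
  moreover have "(\<lambda>k. f (int k)) sums ((Digamma z - Digamma (cnj z)) / (z - cnj z))"
    unfolding f of_int_of_nat_eq using Im_z
    by (intro sums_shifted_product nonint) (auto simp: complex_eq_iff)
  ultimately have A': "A = (Digamma z - Digamma (cnj z)) / (z - cnj z)" by (rule sums_unique2)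
  \<comment> \<open>For n = -1 - k the factors z + n and cnj z + n are the negatives of 1 - z + k
    and 1 - cnj z + k, and the two signs cancel in the product.\<close>
  have "bij_betw (\<lambda>k. - 1 - int k) UNIV {..<0}"
    by (rule bij_betwI[where g = "\<lambda>n. nat (- 1 - n)"]) auto
  hence "((\<lambda>k. f (- 1 - int k)) has_sum B) UNIV"
    using B has_sum_reindex_bij_betw[of "\<lambda>k. - 1 - int k" UNIV "{..<0}" f B] by simp
  hence "(\<lambda>k. f (- 1 - int k)) sums B" by (rule has_sum_imp_sums)
  also have "(\<lambda>k. f (- 1 - int k)) = (\<lambda>k. 1 / ((1 - z + of_nat k) * (1 - cnj z + of_nat k)))"
  proof
    fix k
    have "(z + of_int (- 1 - int k)) * (cnj z + of_int (- 1 - int k)) =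
            (1 - z + of_nat k) * (1 - cnj z + of_nat k)" by (simp add: algebra_simps)
    thus "f (- 1 - int k) = 1 / ((1 - z + of_nat k) * (1 - cnj z + of_nat k))" by (simp only: f)
  qed
  finally have "(\<lambda>k. 1 / ((1 - z + of_nat k) * (1 - cnj z + of_nat k))) sums B" .
  moreover have "(\<lambda>k. 1 / ((1 - z + of_nat k) * (1 - cnj z + of_nat k))) sums
                   ((Digamma (1 - z) - Digamma (1 - cnj z)) / ((1 - z) - (1 - cnj z)))"
    using Im_z by (intro sums_shifted_product nonint) (auto simp: complex_eq_iff)
  ultimately have B': "B = (Digamma (1 - z) - Digamma (1 - cnj z)) / ((1 - z) - (1 - cnj z))"
    by (rule sums_unique2)
  \<comment> \<open>The denominators of A and B are opposite, so the four Digamma values regroup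
    into one reflection pair at z and one at its conjugate.\<close>
  have "S = ((Digamma z - Digamma (1 - z)) - (Digamma (cnj z) - Digamma (1 - cnj z))) / (z - cnj z)"
  proof -
    have "(1 - z) - (1 - cnj z) = - (z - cnj z)" by simp
    thus ?thesis unfolding SAB A' B' by (simp only: minus_divide_right[symmetric])
      (simp add: diff_divide_distrib)
  qed
  also have "Digamma z - Digamma (1 - z) = - of_real pi * cot (of_real pi * z)"
    using Im_z by (intro Digamma_reflection nonint) auto
  also have "Digamma (cnj z) - Digamma (1 - cnj z) = - of_real pi * cot (of_real pi * cnj z)"
    using Im_z by (intro Digamma_reflection nonint) auto
  also have "cot (of_real pi * cnj z) = cnj (cot (of_real pi * z))"
    by (simp add: cot_def cnj_sin cnj_cos)
  also have "cot (of_real pi * z) = - \<i> * ((1 + e) / (1 - e))"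
    using cot_eq_exp[OF Im_z] by (simp add: e_def z_def)
  also have "(- of_real pi * (- \<i> * ((1 + e) / (1 - e))) - - of_real pi * cnj (- \<i> * ((1 + e) / (1 - e)))) /
               (z - cnj z) = of_real pi * (2 * \<i> * of_real (Re ((1 + e) / (1 - e)))) / (z - cnj z)"
  proof -
    have "- of_real pi * (- \<i> * w) - - of_real pi * cnj (- \<i> * w) = of_real pi * (2 * \<i> * of_real (Re w))" for w
      by (simp add: complex_eq_iff)
    thus ?thesis by (simp only:)
  qed
  also have "z - cnj z = 2 * \<i> * of_real (of_int m * Im \<tau>)"
    by (simp add: complex_eq_iff z_def)
  also have "of_real pi * (2 * \<i> * of_real (Re ((1 + e) / (1 - e)))) / (2 * \<i> * of_real (of_int m * Im \<tau>)) =
               of_real (pi / (of_int m * Im \<tau>) * Re ((1 + e) / (1 - e)))"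
    by simp
  finally show ?thesis .
qed

text \<open>The point 1 lies on the boundary of the half-plane in
  \<open>line_integral_eq_Beta\<close>, so the formula for real exponents above 1/2 is used
  instead.\<close>

lemma line_integral_1: "line_integral 1 = of_real pi"
proof -
  have "line_integral 1 = Beta (1/2) (1/2)" using line_integral_of_real[of 1] by simp
  thus ?thesis by (simp add: Beta_altdef Gamma_one_half_complex rGamma_inverse_Gamma flip: of_real_mult)
qed

text \<open>The whole lattice sum diverges at s = 1, but in each row the gaps are the terms minus
  the integrals, both summable. With e = q^m, row m gives pi/(m v) times Re((1 + e)/(1 - e)) - 1,
  where the 1 is the integral, and this is 2 Re(e/(1 - e)).\<close>

lemma lattice_gap_1_sums:
  assumes tau: "Im \<tau> > 0"
  defines "q \<equiv> exp (2 * of_real pi * \<i> * \<tau>)"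
  shows   "(\<lambda>n. of_real (2 * pi / (of_nat (Suc n) * Im \<tau>) * Re (q ^ Suc n / (1 - q ^ Suc n)))) sums
             lattice_gap \<tau> 1"
proof -
  define g where "g = (\<lambda>(m, n). powr_gap (norm_form \<tau> m) (of_int n) 1)"
  have g: "g summable_on {0<..} \<times> UNIV"
    using lattice_gap_summable[OF tau, of 1] by (simp add: g_def)
  hence g_sum: "(g has_sum lattice_gap \<tau> 1) ({0<..} \<times> UNIV)"
    unfolding lattice_gap_def g_def [symmetric] by (rule has_sum_infsum)
  define e where "e = (\<lambda>m::int. exp (2 * of_real pi * \<i> * (of_int m * \<tau>)))"
  have "((\<lambda>n. g (m, n)) has_sum of_real (2 * pi / (of_int m * Im \<tau>) * Re (e m / (1 - e m)))) UNIV"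
    if m: "m \<in> {0<..}" for m
  proof -
    have "(\<lambda>n. g (m, n)) summable_on UNIV"
      by (rule summable_on_SigmaD1[of "\<lambda>m n. g (m, n)"]) (use g m in auto)
    then obtain G where G: "((\<lambda>n. g (m, n)) has_sum G) UNIV" by (auto simp: summable_on_def)
    \<comment> \<open>Adding the integrals back to the gaps of one row recovers the row sum, from
      which the unknown G is then solved.\<close>
    have "((\<lambda>n. g (m, n) + integral {of_int n..of_int n + 1} (\<lambda>x. of_real (norm_form \<tau> m x) powr (- 1)))
            has_sum (G + of_real (of_int m * Im \<tau>) powr (1 - 2 * 1) * line_integral 1)) UNIV"
      by (intro has_sum_add G has_sum_integral_norm_form tau) (use m in auto)
    hence "((\<lambda>n. of_real (norm_form \<tau> m (of_int n)) powr (- 1)) has_sum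
            (G + of_real (of_int m * Im \<tau>) powr (1 - 2 * 1) * line_integral 1)) UNIV"
      by (simp add: g_def powr_gap_def)
    from sum_inverse_norm_form[OF tau _ this] m
    have "G = of_real (pi / (of_int m * Im \<tau>) * Re ((1 + e m) / (1 - e m))) -
                of_real (of_int m * Im \<tau>) powr (- 1) * of_real pi"
      by (simp add: e_def line_integral_1 algebra_simps)
    also have "of_real (of_int m * Im \<tau>) powr (- 1) * of_real pi = (of_real (pi / (of_int m * Im \<tau>)) :: complex)"
      using m tau by (simp add: powr_minus field_simps)
    also have "of_real (pi / (of_int m * Im \<tau>) * Re ((1 + e m) / (1 - e m))) - of_real (pi / (of_int m * Im \<tau>)) =
                 (of_real (pi / (of_int m * Im \<tau>) * (Re ((1 + e m) / (1 - e m)) - 1)) :: complex)"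
      by (simp only: of_real_diff[symmetric] right_diff_distrib mult_1_right)
    also have "Re ((1 + e m) / (1 - e m)) - 1 = 2 * Re (e m / (1 - e m))"
    proof -
      have "norm (e m) < 1" using m tau by (simp add: e_def)
      hence "1 - e m \<noteq> 0" by auto
      hence "(1 + e m) / (1 - e m) = (1 - e m) / (1 - e m) + (e m + e m) / (1 - e m)"
        by (subst add_divide_distrib[symmetric]) simp
      also have "\<dots> = 1 + (e m / (1 - e m) + e m / (1 - e m))"
        using \<open>1 - e m \<noteq> 0\<close> by (simp add: add_divide_distrib)
      finally have "(1 + e m) / (1 - e m) = 1 + (e m / (1 - e m) + e m / (1 - e m))" .
      thus ?thesis by (simp only: plus_complex.sel one_complex.sel)
    qed
    finally show ?thesis using G by (simp add: mult_ac)
  qed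
  hence "((\<lambda>m. of_real (2 * pi / (of_int m * Im \<tau>) * Re (e m / (1 - e m)))) has_sum lattice_gap \<tau> 1) {0<..}"
    by (rule has_sum_SigmaD[OF g_sum])
  hence "(\<lambda>n. of_real (2 * pi / (of_int (int (Suc n)) * Im \<tau>) * Re (e (int (Suc n)) / (1 - e (int (Suc n))))))
           sums lattice_gap \<tau> 1"
    unfolding has_sum_pos_int_iff by (rule has_sum_imp_sums)
  moreover have "e (int (Suc n)) = q ^ Suc n" for n
    unfolding e_def q_def by (subst exp_of_nat_mult[symmetric]) (simp add: mult_ac)
  ultimately show ?thesis by (simp only: of_int_of_nat_eq)
qed

section \<open>From the lattice gaps at 1 to \<open>g1\<close>\<close>

lemma sums_g1:
  assumes "norm q < 1"
  shows   "(\<lambda>n. q ^ Suc n / (of_nat (Suc n) * (1 + q ^ Suc n))) sums g1 q"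
proof -
  have "summable (\<lambda>n. q ^ Suc n / (of_nat (Suc n) * (1 + q ^ Suc n)))"
  proof (rule summable_comparison_test')
    show "summable (\<lambda>n. norm q ^ n * (norm q / (1 - norm q)))"
      using assms by (intro summable_mult2 summable_geometric) simp
    fix n :: nat
    have "norm (q ^ Suc n) \<le> norm q ^ 1"
      unfolding norm_power by (rule power_decreasing) (use assms in auto)
    moreover have "1 - norm (q ^ Suc n) \<le> norm (1 + q ^ Suc n)"
      using norm_diff_ineq[of 1 "q ^ Suc n"] by simp
    ultimately have "1 - norm q \<le> norm (1 + q ^ Suc n)" by simp
    hence "1 * (1 - norm q) \<le> norm (of_nat (Suc n) * (1 + q ^ Suc n))"
      unfolding norm_mult using assms by (intro mult_mono) (auto simp del: of_nat_Suc)
    hence "norm (q ^ Suc n) / norm (of_nat (Suc n) * (1 + q ^ Suc n)) \<le> norm (q ^ Suc n) / (1 - norm q)"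
      using assms by (intro divide_left_mono mult_pos_pos) auto
    thus "norm (q ^ Suc n / (of_nat (Suc n) * (1 + q ^ Suc n))) \<le> norm q ^ n * (norm q / (1 - norm q))"
      unfolding norm_divide by (simp add: norm_power norm_mult mult_ac)
  qed
  thus ?thesis by (simp only: g1_def summable_sums)
qed

text \<open>The weight 4 is the factor 2 in front of E(2\<tau>; s) times the 2 in Im (2\<tau>) = 2v.
  The row formula for 2\<tau> carries 2v in its denominator, which leaves weight 2 on the terms with
  q squared, exactly what the splitting of x/(1 + x) requires.\<close>

lemma lattice_gap_combination:
  assumes tau: "Im \<tau> > 0"
  defines "q \<equiv> exp (2 * of_real pi * \<i> * \<tau>)"
  shows   "of_real (Im \<tau>) * (lattice_gap \<tau> 1 - 4 * lattice_gap (2 * \<tau>) 1) = of_real pi * (g1 q + g1 (cnj q))"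
proof -
  define v where "v = Im \<tau>"
  have v: "v > 0" using tau by (simp add: v_def)
  have q: "norm q < 1" using tau by (simp add: q_def)
  have "exp (2 * of_real pi * \<i> * (2 * \<tau>)) = q\<^sup>2"
    unfolding q_def exp_double[symmetric] by (simp add: mult_ac)
  hence *: "(\<lambda>n. of_real v * (of_real (2 * pi / (of_nat (Suc n) * v) * Re (q ^ Suc n / (1 - q ^ Suc n))) -
              4 * of_real (2 * pi / (of_nat (Suc n) * (2 * v)) * Re ((q\<^sup>2) ^ Suc n / (1 - (q\<^sup>2) ^ Suc n))))) sums
             (of_real v * (lattice_gap \<tau> 1 - 4 * lattice_gap (2 * \<tau>) 1))"
    using lattice_gap_1_sums[OF tau] lattice_gap_1_sums[of "2 * \<tau>"] tau
    unfolding q_def[symmetric] v_def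
    by (intro sums_mult sums_diff) (simp_all add: of_real_def)
  have "(\<lambda>n. of_real pi * (q ^ Suc n / (of_nat (Suc n) * (1 + q ^ Suc n)) +
            cnj q ^ Suc n / (of_nat (Suc n) * (1 + cnj q ^ Suc n)))) sums (of_real pi * (g1 q + g1 (cnj q)))"
    using q by (intro sums_mult sums_add sums_g1) auto
  also have "(\<lambda>n. of_real pi * (q ^ Suc n / (of_nat (Suc n) * (1 + q ^ Suc n)) +
            cnj q ^ Suc n / (of_nat (Suc n) * (1 + cnj q ^ Suc n)))) =
      (\<lambda>n. of_real v * (of_real (2 * pi / (of_nat (Suc n) * v) * Re (q ^ Suc n / (1 - q ^ Suc n))) -
              4 * of_real (2 * pi / (of_nat (Suc n) * (2 * v)) * Re ((q\<^sup>2) ^ Suc n / (1 - (q\<^sup>2) ^ Suc n)))))"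
  proof
    fix n :: nat
    define N where "N = real (Suc n)"
    have N: "N > 0" by (simp add: N_def)
    define x where "x = q ^ Suc n"
    have "norm x < 1" using q power_less_one_iff[of "norm q" "Suc n"] by (simp only: x_def norm_power) simp
    hence "x \<noteq> 1" "x \<noteq> - 1" by auto
    hence x: "1 - x \<noteq> 0" "1 + x \<noteq> 0" by (auto simp: add_eq_0_iff)
    have split: "x / (1 + x) = x / (1 - x) - 2 * (x\<^sup>2 / (1 - x\<^sup>2))"
    proof -
      have "1 - x\<^sup>2 = (1 - x) * (1 + x)" by (simp add: power2_eq_square algebra_simps)
      thus ?thesis using x by (simp add: divide_simps) (simp add: power2_eq_square algebra_simps)
    qed
    have re: "w / of_real N + cnj w / of_real N = of_real (2 / N * Re w)" for w
      by (simp add: complex_eq_iff)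
    have "of_real pi * (x / (of_real N * (1 + x)) + cnj x / (of_real N * (1 + cnj x))) =
            of_real pi * (x / (1 + x) / of_real N + cnj (x / (1 + x)) / of_real N)"
      by (simp add: mult.commute)
    also have "\<dots> = of_real pi * of_real (2 / N * Re (x / (1 + x)))" by (simp only: re)
    also have "\<dots> = of_real (pi * (2 / N * (Re (x / (1 - x)) - 2 * Re (x\<^sup>2 / (1 - x\<^sup>2)))))"
    proof -
      have "Re (2 * w) = 2 * Re w" for w by simp
      thus ?thesis unfolding split by (simp only: minus_complex.sel of_real_mult)
    qed
    also have "pi * (2 / N * (Re (x / (1 - x)) - 2 * Re (x\<^sup>2 / (1 - x\<^sup>2)))) =
                 v * (2 * pi / (N * v) * Re (x / (1 - x)) - 4 * (2 * pi / (N * (2 * v)) * Re (x\<^sup>2 / (1 - x\<^sup>2))))"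
      using v N by (simp add: field_simps)
    also have "(of_real \<dots> :: complex) = of_real v * (of_real (2 * pi / (N * v) * Re (x / (1 - x))) -
                  4 * of_real (2 * pi / (N * (2 * v)) * Re (x\<^sup>2 / (1 - x\<^sup>2))))"
      by (simp only: of_real_mult of_real_diff of_real_numeral)
    finally show "of_real pi * (q ^ Suc n / (of_nat (Suc n) * (1 + q ^ Suc n)) +
            cnj q ^ Suc n / (of_nat (Suc n) * (1 + cnj q ^ Suc n))) =
      of_real v * (of_real (2 * pi / (of_nat (Suc n) * v) * Re (q ^ Suc n / (1 - q ^ Suc n))) -
              4 * of_real (2 * pi / (of_nat (Suc n) * (2 * v)) * Re ((q\<^sup>2) ^ Suc n / (1 - (q\<^sup>2) ^ Suc n))))"
      by (simp only: x_def N_def complex_cnj_power power_mult[symmetric] mult.commute[of _ 2] of_real_of_nat_eq)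
  qed
  finally show ?thesis using * unfolding v_def by (rule sums_unique2[rotated])
qed

subsection \<open>Continuation to a neighbourhood of 1\<close>

text \<open>The identity \<open>eisenstein_series_times_zeta\<close> solved for the Eisenstein
  series, with zeta(2s - 1) replaced by its pole 1/(2(s - 1)) plus its regular part. At s = 1 itself
  the division by zero gives an arbitrary value.\<close>

definition continued_eisenstein :: "complex \<Rightarrow> complex \<Rightarrow> complex" where
  "continued_eisenstein \<tau> s = of_real (Im \<tau>) powr s +
     (of_real (Im \<tau>) powr (1 - s) * Beta (1/2) (s - 1/2) * (1 / (2 * (s - 1)) + zeta_reg (2 * s - 1)) +
      of_real (Im \<tau>) powr s * lattice_gap \<tau> s) / riemann_zeta (2 * s)"

lemma eisenstein_series_eq_continued:
  assumes tau: "Im \<tau> > 0" and s: "Re s > 1"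
  shows   "eisenstein_series \<tau> s = continued_eisenstein \<tau> s"
proof -
  define v where "v = complex_of_real (Im \<tau>)"
  have v: "v \<noteq> 0" using tau by (simp add: v_def)
  have nz: "riemann_zeta (2 * s) \<noteq> 0" using s by (intro riemann_zeta_ne_0) auto
  have "riemann_zeta (2 * s - 1) = 1 / ((2 * s - 1) - 1) + zeta_reg (2 * s - 1)"
    using s by (intro riemann_zeta_eq_zeta_reg) auto
  hence Z: "riemann_zeta (2 * s - 1) = 1 / (2 * (s - 1)) + zeta_reg (2 * s - 1)"
    by (simp add: algebra_simps)
  have p: "v powr s * v powr (1 - 2 * s) = v powr (1 - s)"
    by (simp flip: powr_add)
  have "riemann_zeta (2 * s) * eisenstein_series \<tau> s = riemann_zeta (2 * s) * v powr s +
          (v powr s * v powr (1 - 2 * s)) * Beta (1/2) (s - 1/2) * riemann_zeta (2 * s - 1) + v powr s * lattice_gap \<tau> s"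
    by (subst eisenstein_series_times_zeta[OF assms]) (simp only: v_def ring_distribs mult_ac add_ac)
  also have "\<dots> = riemann_zeta (2 * s) * continued_eisenstein \<tau> s"
    unfolding p Z continued_eisenstein_def v_def[symmetric] ring_distribs(1)[of "riemann_zeta (2 * s)"]
    using nz by simp
  finally show ?thesis using nz by simp
qed

text \<open>For Re s > 1 the argument 2s lies in Re \<ge> 2; the rest of the ball uses continuity at
  2. The cap 1/4 keeps Re s > 3/4, hence Re (2s) > 3/2 and Re (2s - 1) > 1/2, inside the domains of
  all the ingredients.\<close>

lemma riemann_zeta_ne_0_near_2:
  obtains r where "r > 0" "r \<le> 1/4" "\<And>s. Re s > 1 \<or> s \<in> ball 1 r \<Longrightarrow> riemann_zeta (2 * s) \<noteq> 0"
proof -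
  have "continuous_on {s. Re s > 1} riemann_zeta"
    by (intro holomorphic_on_imp_continuous_on holomorphic_riemann_zeta)
  hence "isCont riemann_zeta 2"
    by (subst (asm) continuous_on_eq_continuous_at) (auto simp: open_halfspace_Re_gt)
  moreover have "riemann_zeta 2 \<noteq> 0" by (intro riemann_zeta_ne_0) auto
  ultimately obtain d where d: "d > 0" "\<And>w. dist 2 w < d \<Longrightarrow> riemann_zeta w \<noteq> 0"
    using continuous_at_avoid[of 2 riemann_zeta 0] by metis
  show ?thesis
  proof (rule that[of "min (1/4) (d / 2)"])
    fix s assume "Re s > 1 \<or> s \<in> ball 1 (min (1/4) (d / 2))"
    thus "riemann_zeta (2 * s) \<noteq> 0"
    proof
      assume "s \<in> ball 1 (min (1/4) (d / 2))"
      hence "norm (2 * (1 - s)) < d" unfolding norm_mult by (simp add: dist_norm)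
      hence "dist 2 (2 * s) < d" by (simp add: dist_norm algebra_simps)
      thus ?thesis by (rule d(2))
    qed (use riemann_zeta_ne_0[of "2 * s"] in auto)
  qed (use d in auto)
qed

lemma Re_gt_if_near_1:
  assumes "Re s > 1 \<or> s \<in> ball 1 r" "r \<le> 1/4"
  shows   "Re s > 3/4"
proof -
  have "Re (1 - s) \<le> norm (1 - s)" by (rule complex_Re_le_cmod)
  thus ?thesis using assms by (auto simp: dist_norm)
qed

lemma holomorphic_Beta_half: "(\<lambda>s. Beta (1/2) (s - 1/2)) holomorphic_on {s. Re s > 1/2}"
proof -
  have "s - 1/2 \<notin> \<int>\<^sub>\<le>\<^sub>0" if "Re s > 1/2" for s :: complex
    using that by (auto elim!: nonpos_Ints_cases dest!: arg_cong[of _ _ Re])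
  moreover have "(1/2 :: complex) \<notin> \<int>\<^sub>\<le>\<^sub>0"
    by (auto elim!: nonpos_Ints_cases simp: complex_eq_iff)
  ultimately show ?thesis by (intro holomorphic_intros) auto
qed

text \<open>The possible pole at 1 is isolated in a single quotient, so that meromorphy on the whole
  domain and analyticity away from 1 can both be read off.\<close>

lemma continued_eisenstein_decomposition:
  assumes tau: "Im \<tau> > 0" and r: "r \<le> 1/4"
  assumes nz: "\<And>s. Re s > 1 \<or> s \<in> ball 1 r \<Longrightarrow> riemann_zeta (2 * s) \<noteq> 0"
  defines "A \<equiv> {s. Re s > 1} \<union> ball 1 r"
  obtains f g where "f analytic_on A" "g analytic_on A"
    "continued_eisenstein \<tau> = (\<lambda>s. f s + g s / (s - 1))"
proof -
  have A: "Re s > 3/4" if "s \<in> A" for s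
    using that Re_gt_if_near_1[OF _ r] by (auto simp: A_def)
  have "open A" by (auto simp: A_def open_halfspace_Re_gt)
  \<comment> \<open>Since Re s > 3/4 on A, the real part of 2s - c exceeds 3/2 - Re c, whence the
    side condition on x and c.\<close>
  have comp: "(\<lambda>s. h (2 * s - c)) holomorphic_on A"
    if "h holomorphic_on {s. Re s > x}" "x + Re c < 3/2" for h c x
  proof -
    have "(\<lambda>s. 2 * s - c) ` A \<subseteq> {s. Re s > x}" using A that(2) by fastforce
    moreover have "(\<lambda>s. 2 * s - c) holomorphic_on A" by (intro holomorphic_intros)
    ultimately show ?thesis
      using holomorphic_on_compose_gen[OF _ that(1), of "\<lambda>s. 2 * s - c" A] by (simp add: o_def)
  qed
  have zeta: "(\<lambda>s. riemann_zeta (2 * s)) holomorphic_on A"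
    using comp[OF holomorphic_riemann_zeta, of 0] by simp
  have reg: "(\<lambda>s. zeta_reg (2 * s - 1)) holomorphic_on A"
    using comp[OF holomorphic_zeta_reg, of 1] by simp
  have gap: "lattice_gap \<tau> holomorphic_on A"
    by (rule holomorphic_on_subset[OF holomorphic_lattice_gap[OF tau]]) (use A in fastforce)
  have beta: "(\<lambda>s. Beta (1/2) (s - 1/2)) holomorphic_on A"
    by (rule holomorphic_on_subset[OF holomorphic_Beta_half]) (use A in fastforce)
  define f where "f = (\<lambda>s. of_real (Im \<tau>) powr s +
     (of_real (Im \<tau>) powr (1 - s) * Beta (1/2) (s - 1/2) * zeta_reg (2 * s - 1) +
      of_real (Im \<tau>) powr s * lattice_gap \<tau> s) / riemann_zeta (2 * s))"
  define g where "g = (\<lambda>s. of_real (Im \<tau>) powr (1 - s) * Beta (1/2) (s - 1/2) / 2 / riemann_zeta (2 * s))"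
  show ?thesis
  proof (rule that[of f g])
    have nz': "riemann_zeta (2 * s) \<noteq> 0" if "s \<in> A" for s
      using that nz[of s] by (auto simp: A_def)
    have "f holomorphic_on A" unfolding f_def
      by (intro holomorphic_intros zeta reg gap beta nz') auto
    thus "f analytic_on A" using \<open>open A\<close> by (simp add: analytic_on_open)
    have "g holomorphic_on A" unfolding g_def
      by (intro holomorphic_intros zeta beta nz') auto
    thus "g analytic_on A" using \<open>open A\<close> by (simp add: analytic_on_open)
    show "continued_eisenstein \<tau> = (\<lambda>s. f s + g s / (s - 1))"
      by (rule ext) (simp add: continued_eisenstein_def f_def g_def add_divide_distrib ring_distribs mult_ac)
  qed
qed

text \<open>A nicely meromorphic function takes the value 0 at a pole and its limit elsewhere.
  \<open>remove_sings\<close> enforces this at 1, where the formula has an arbitrary value.\<close>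

lemma continued_eisenstein_is_continuation:
  assumes tau: "Im \<tau> > 0"
  shows   "is_continuation_near_1 (eisenstein_series \<tau>) (remove_sings (continued_eisenstein \<tau>))"
    and   "continued_eisenstein \<tau> meromorphic_on {1}"
proof -
  obtain r where r: "r > 0" "r \<le> 1/4" "\<And>s. Re s > 1 \<or> s \<in> ball 1 r \<Longrightarrow> riemann_zeta (2 * s) \<noteq> 0"
    using riemann_zeta_ne_0_near_2 by metis
  obtain f g where fg: "f analytic_on {s. Re s > 1} \<union> ball 1 r" "g analytic_on {s. Re s > 1} \<union> ball 1 r"
    "continued_eisenstein \<tau> = (\<lambda>s. f s + g s / (s - 1))"
    using continued_eisenstein_decomposition[OF tau r(2,3)] by metis
  have mero: "continued_eisenstein \<tau> meromorphic_on {s. Re s > 1} \<union> ball 1 r"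
    unfolding fg(3) by (intro meromorphic_intros analytic_on_imp_meromorphic_on fg(1,2))
  show "continued_eisenstein \<tau> meromorphic_on {1}"
    by (rule meromorphic_on_subset[OF mero]) (use r in auto)
  \<comment> \<open>Where the formula is analytic, \<open>remove_sings\<close> leaves its value
    unchanged, so agreement with the series for Re s > 1 survives.\<close>
  have "continued_eisenstein \<tau> analytic_on {s}" if "Re s > 1" for s
    unfolding fg(3)
    by (intro analytic_intros analytic_on_subset[OF fg(1)] analytic_on_subset[OF fg(2)]) (use that in auto)
  thus "is_continuation_near_1 (eisenstein_series \<tau>) (remove_sings (continued_eisenstein \<tau>))"
    unfolding is_continuation_near_1_def
    using r(1) mero eisenstein_series_eq_continued[OF tau]
    by (auto intro!: exI[of _ r] remove_sings_nicely_meromorphic)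
qed

text \<open>Whichever continuation was chosen, its difference from the explicit formula is
  meromorphic at 1 and vanishes for Re s > 1. Zeros that accumulate at 1 force the difference to
  vanish on a punctured neighbourhood.\<close>

lemma eisenstein_E_eq_continued:
  assumes tau: "Im \<tau> > 0"
  shows   "\<forall>\<^sub>F s in at 1. eisenstein_E \<tau> s = continued_eisenstein \<tau> s"
proof -
  define h where "h = (\<lambda>s. eisenstein_E \<tau> s - continued_eisenstein \<tau> s)"
  have "is_continuation_near_1 (eisenstein_series \<tau>) (eisenstein_E \<tau>)"
    unfolding eisenstein_E_def
    using continued_eisenstein_is_continuation(1)[OF tau]
    by (rule someI[where P = "is_continuation_near_1 (eisenstein_series \<tau>)"])
  then obtain r where r: "r > 0" "eisenstein_E \<tau> nicely_meromorphic_on ({s. Re s > 1} \<union> ball 1 r)"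
    and eq: "\<And>s. Re s > 1 \<Longrightarrow> eisenstein_E \<tau> s = eisenstein_series \<tau> s"
    unfolding is_continuation_near_1_def by blast
  have "eisenstein_E \<tau> meromorphic_on {1}"
    by (rule meromorphic_on_subset[of _ "{s. Re s > 1} \<union> ball 1 r"])
       (use r in \<open>auto simp: nicely_meromorphic_on_def\<close>)
  hence "h meromorphic_on {1}"
    unfolding h_def by (intro meromorphic_intros continued_eisenstein_is_continuation tau)
  hence h: "isolated_singularity_at h 1" "not_essential h 1"
    by (simp_all add: meromorphic_at_iff)
  have "\<exists>\<^sub>F s in at 1. h s = 0"
  proof -
    \<comment> \<open>The points 1 + 1/(n+1) lie in the half-plane of convergence and tend to
      1.\<close>
    have "filterlim (\<lambda>n. 1 + of_real (1 / real (Suc n))) (at (1 :: complex)) sequentially"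
    proof (rule filterlim_atI)
      have "(\<lambda>n. 1 + of_real (1 / real (Suc n)) :: complex) \<longlonglongrightarrow> 1 + of_real 0"
        by (intro tendsto_intros LIMSEQ_Suc[OF lim_1_over_n])
      thus "(\<lambda>n. 1 + of_real (1 / real (Suc n)) :: complex) \<longlonglongrightarrow> 1" by simp
    qed (simp del: of_nat_Suc)
    moreover have "h (1 + of_real (1 / real (Suc n))) = 0" for n
      using eq[of "1 + of_real (1 / real (Suc n))"] eisenstein_series_eq_continued[OF tau]
      by (simp add: h_def del: of_nat_Suc)
    ultimately show ?thesis
      unfolding frequently_def using eventually_compose_filterlim[of "\<lambda>s. \<not> h s = 0" "at 1" _ sequentially]
      by fastforce
  qed
  hence "\<forall>\<^sub>F s in at 1. h s = 0"
    by (rule not_essential_frequently_0_imp_eventually_0[OF h])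
  thus ?thesis by (simp add: h_def)
qed

subsection \<open>The limit formula\<close>

lemma Beta_half_half: "Beta (1/2) (1/2 :: complex) = of_real pi"
  by (simp add: Beta_altdef Gamma_one_half_complex rGamma_inverse_Gamma flip: of_real_mult)

text \<open>The logarithmic derivative is Digamma(1/2) - Digamma(1) = -2 ln 2, in which Euler's
  constant cancels.\<close>

lemma has_field_derivative_Beta_half:
  "((\<lambda>s. Beta (1/2) (s - 1/2)) has_field_derivative of_real pi * (- of_real (2 * ln 2)))
     (at (1 :: complex))"
proof -
  have "(1/2 :: complex) \<notin> \<int>\<^sub>\<le>\<^sub>0"
    by (auto elim!: nonpos_Ints_cases simp: complex_eq_iff)
  hence "((\<lambda>y. Beta (1/2) y) has_field_derivative Beta (1/2) (1/2) * (Digamma (1/2) - Digamma (1/2 + 1/2)))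
           (at (1 - 1/2 :: complex))"
    using has_field_derivative_Beta2[of "1/2 :: complex" "1/2" UNIV] by simp
  moreover have "((\<lambda>s. s - 1/2) has_field_derivative 1) (at (1 :: complex))"
    by (auto intro!: derivative_eq_intros)
  ultimately show ?thesis
    using DERIV_chain2[of "Beta (1/2)" _ "\<lambda>s. s - 1/2" "1 :: complex" 1 UNIV]
    by (simp add: Beta_half_half Digamma_one_half)
qed

theorem theorem1p2:
  fixes \<tau> :: complex
  assumes "Im \<tau> > 0"
  shows "\<exists>L. ((\<lambda>s. 2 * eisenstein_E (2 * \<tau>) s - eisenstein_E \<tau> s
                   - 3 / (of_real pi * (s - 1))) \<longlongrightarrow> L) (at 1)
             \<and> g1_hat \<tau> = - (of_real pi / 6) * L"
proof -
  define v where "v = Im \<tau>"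
  have v: "v > 0" using assms by (simp add: v_def)
  define \<zeta>' where "\<zeta>' = deriv riemann_zeta 2"
  \<comment> \<open>With these names, 2E(2\<tau>; s) - E(\<tau>; s) is A + C + B (1/(2(s - 1)) +
    \<open>zeta_reg\<close> (2s - 1)) near 1: A comes from the row m = 0, B from the integrals and C
    from the gaps.\<close>
  define A where "A = (\<lambda>s. 2 * of_real (2 * v) powr s - of_real v powr s :: complex)"
  define B where "B = (\<lambda>s. (2 * of_real (2 * v) powr (1 - s) - of_real v powr (1 - s)) *
                            Beta (1/2) (s - 1/2) / riemann_zeta (2 * s) :: complex)"
  define C where "C = (\<lambda>s. (2 * of_real (2 * v) powr s * lattice_gap (2 * \<tau>) s -
                            of_real v powr s * lattice_gap \<tau> s) / riemann_zeta (2 * s))"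
  \<comment> \<open>The derivative of B at 1, namely B(1) = 6/pi times the logarithmic derivative:
    -2 ln 2 - ln v from the powers, -2 ln 2 from Beta, and -2 zeta'(2)/zeta(2) = -12 zeta'(2)/pi^2
    from the denominator.\<close>
  define B' where "B' = 6 / of_real pi * (- of_real (ln v) - 4 * of_real (ln 2) - 12 * \<zeta>' / of_real pi ^ 2)"
  have zeta2: "riemann_zeta 2 = of_real pi ^ 2 / 6"
    by (simp add: riemann_zeta_2)
  \<comment> \<open>Hence B(1)/(2(s - 1)) is exactly the subtracted term 3/(pi (s - 1)).\<close>
  have B1: "B 1 = 6 / of_real pi"
    using v by (simp add: B_def Beta_half_half zeta2 power2_eq_square)
  have zeta_deriv: "((\<lambda>s. riemann_zeta (2 * s)) has_field_derivative \<zeta>' * 2) (at 1)"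
  proof -
    have "(riemann_zeta has_field_derivative \<zeta>') (at (2 * 1))"
      unfolding \<zeta>'_def using holomorphic_derivI[OF holomorphic_riemann_zeta, of 2]
      by (simp add: open_halfspace_Re_gt)
    moreover have "((\<lambda>s. 2 * s) has_field_derivative 2) (at (1 :: complex))"
      by (auto intro!: derivative_eq_intros)
    ultimately show ?thesis by (rule DERIV_chain2)
  qed
  have powr_deriv: "((\<lambda>s. of_real c powr (1 - s)) has_field_derivative - of_real (ln c)) (at (1 :: complex))"
    if "c > 0" for c
  proof -
    have "((\<lambda>s. exp ((1 - s) * of_real (ln c))) has_field_derivative - of_real (ln c)) (at (1 :: complex))"
      by (auto intro!: derivative_eq_intros)
    thus ?thesis using that by (simp add: of_real_powr_eq_exp)
  qed
  have "(B has_field_derivative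
           (((2 * (- of_real (ln (2 * v))) - (- of_real (ln v))) * Beta (1/2) (1 - 1/2) +
             of_real pi * (- of_real (2 * ln 2)) *
               (2 * of_real (2 * v) powr (1 - 1) - of_real v powr (1 - 1))) * riemann_zeta (2 * 1) -
            (2 * of_real (2 * v) powr (1 - 1) - of_real v powr (1 - 1)) * Beta (1/2) (1 - 1/2) * (\<zeta>' * 2)) /
           (riemann_zeta (2 * 1) * riemann_zeta (2 * 1))) (at 1)"
    unfolding B_def
    by (intro DERIV_divide DERIV_mult DERIV_diff DERIV_cmult powr_deriv has_field_derivative_Beta_half zeta_deriv)
       (use v in \<open>simp_all add: riemann_zeta_ne_0\<close>)
  also have "(((2 * (- of_real (ln (2 * v))) - (- of_real (ln v))) * Beta (1/2) (1 - 1/2) +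
             of_real pi * (- of_real (2 * ln 2)) *
               (2 * of_real (2 * v) powr (1 - 1) - of_real v powr (1 - 1))) * riemann_zeta (2 * 1) -
            (2 * of_real (2 * v) powr (1 - 1) - of_real v powr (1 - 1)) * Beta (1/2) (1 - 1/2) * (\<zeta>' * 2)) /
           (riemann_zeta (2 * 1) * riemann_zeta (2 * 1)) = B'"
  proof -
    have "ln (2 * v) = ln 2 + ln v" using v by (simp add: ln_mult)
    thus ?thesis using v
      by (simp add: Beta_half_half zeta2 B'_def divide_simps power2_eq_square)
         (simp add: algebra_simps)
  qed
  finally have B_deriv: "(B has_field_derivative B') (at 1)" .
  hence "((\<lambda>s. (B s - B 1) / (s - 1)) \<longlongrightarrow> B') (at 1)"
    by (simp add: has_field_derivative_iff)
  moreover have "(B \<longlongrightarrow> B 1) (at 1)"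
    using B_deriv by (intro isContD DERIV_isCont)
  moreover have powr_lim: "((\<lambda>s. of_real c powr s) \<longlongrightarrow> (of_real c :: complex)) (at 1)" if "c > 0" for c
  proof -
    have "((\<lambda>s. of_real c powr s) \<longlongrightarrow> (of_real c :: complex) powr 1) (at 1)"
      using that by (intro tendsto_intros) auto
    thus ?thesis using that by simp
  qed
  have "(A \<longlongrightarrow> 3 * of_real v) (at 1)"
  proof -
    have "(A \<longlongrightarrow> 2 * of_real (2 * v) - of_real v) (at 1)"
      unfolding A_def by (intro tendsto_diff tendsto_mult tendsto_const powr_lim) (use v in auto)
    thus ?thesis by simp
  qed
  moreover have gap_lim: "(lattice_gap \<tau>' \<longlongrightarrow> lattice_gap \<tau>' 1) (at 1)" if "Im \<tau>' > 0" for \<tau>'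
  proof -
    have "continuous_on {s. Re s > 1/2} (lattice_gap \<tau>')"
      by (intro holomorphic_on_imp_continuous_on holomorphic_lattice_gap that)
    hence "isCont (lattice_gap \<tau>') 1"
      by (subst (asm) continuous_on_eq_continuous_at[OF open_halfspace_Re_gt]) auto
    thus ?thesis by (rule isContD)
  qed
  have zeta_lim: "((\<lambda>s. riemann_zeta (2 * s)) \<longlongrightarrow> riemann_zeta (2 * 1)) (at 1)"
    using zeta_deriv by (intro isContD DERIV_isCont)
  have "(C \<longlongrightarrow> (2 * of_real (2 * v) * lattice_gap (2 * \<tau>) 1 - of_real v * lattice_gap \<tau> 1) / riemann_zeta (2 * 1)) (at 1)"
    unfolding C_def
    by (intro tendsto_divide tendsto_diff tendsto_mult tendsto_const powr_lim gap_lim zeta_lim)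
       (use v assms in \<open>simp_all add: riemann_zeta_ne_0\<close>)
  moreover have "((\<lambda>s. zeta_reg (2 * s - 1)) \<longlongrightarrow> euler_mascheroni) (at 1)"
  proof -
    have "continuous_on {s. Re s > 0} zeta_reg"
      by (intro holomorphic_on_imp_continuous_on holomorphic_zeta_reg)
    hence "isCont zeta_reg 1"
      by (subst (asm) continuous_on_eq_continuous_at[OF open_halfspace_Re_gt]) auto
    hence "(zeta_reg \<longlongrightarrow> zeta_reg 1) (nhds 1)"
      by (simp only: continuous_at tendsto_at_iff_tendsto_nhds)
    moreover have "((\<lambda>s. 2 * s - 1) \<longlongrightarrow> (1 :: complex)) (at 1)"
      by (auto intro!: tendsto_eq_intros)
    ultimately show ?thesis unfolding zeta_reg_1 by (rule filterlim_compose)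
  qed
  \<comment> \<open>After the subtraction, the polar part is half the difference quotient of B at 1,
    which tends to half its derivative.\<close>
  ultimately have lim: "((\<lambda>s. A s + C s + B s * zeta_reg (2 * s - 1) + (B s - B 1) / (s - 1) / 2) \<longlongrightarrow>
      3 * of_real v + (2 * of_real (2 * v) * lattice_gap (2 * \<tau>) 1 - of_real v * lattice_gap \<tau> 1) / riemann_zeta (2 * 1) +
      B 1 * euler_mascheroni + B' / 2) (at 1)" (is "(_ \<longlongrightarrow> ?L) _")
    by (intro tendsto_intros) auto
  have "\<forall>\<^sub>F s in at 1. eisenstein_E (2 * \<tau>) s = continued_eisenstein (2 * \<tau>) s"
       "\<forall>\<^sub>F s in at 1. eisenstein_E \<tau> s = continued_eisenstein \<tau> s"
    using assms by (intro eisenstein_E_eq_continued; simp)+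
  hence "\<forall>\<^sub>F s in at 1. A s + C s + B s * zeta_reg (2 * s - 1) + (B s - B 1) / (s - 1) / 2 =
           2 * eisenstein_E (2 * \<tau>) s - eisenstein_E \<tau> s - 3 / (of_real pi * (s - 1))"
  proof eventually_elim
    case (elim s)
    have "B 1 / (s - 1) / 2 = 3 / (of_real pi * (s - 1))"
      by (simp add: B1)
    moreover have "2 * continued_eisenstein (2 * \<tau>) s - continued_eisenstein \<tau> s =
       A s + C s + B s * zeta_reg (2 * s - 1) + B s / (s - 1) / 2"
    proof -
      define p1 p2 p3 p4 where "p1 = (of_real (2 * v) :: complex) powr s" "p2 = (of_real v :: complex) powr s"
         "p3 = (of_real (2 * v) :: complex) powr (1 - s)" "p4 = (of_real v :: complex) powr (1 - s)"
      define b where "b = Beta (1/2) (s - 1/2)"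
      define t where "t = 1 / (2 * (s - 1))"
      have t: "x / (s - 1) / 2 = x * t" for x by (simp add: t_def mult.commute)
      have "Im (2 * \<tau>) = 2 * v" "Im \<tau> = v" by (simp_all add: v_def)
      thus ?thesis
        unfolding continued_eisenstein_def A_def B_def C_def t
        unfolding t_def[symmetric] b_def[symmetric] p1_p2_p3_p4_def[symmetric]
        by (simp only: p1_p2_p3_p4_def[symmetric]) (simp add: add_divide_distrib diff_divide_distrib algebra_simps)
    qed
    ultimately show ?case
      by (simp only: elim diff_divide_distrib) simp
  qed
  with lim have "((\<lambda>s. 2 * eisenstein_E (2 * \<tau>) s - eisenstein_E \<tau> s
                   - 3 / (of_real pi * (s - 1))) \<longlongrightarrow> ?L) (at 1)"
    by (rule Lim_transform_eventually)
  \<comment> \<open>Multiplied by -pi/6, the term 3v gives -pi v/2, the term B(1) gamma gives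
    -gamma, half of \<open>B'\<close> gives ln v/2 + 2 ln 2 + 6 zeta'(2)/pi^2, and the gaps divided
    by zeta(2) = pi^2/6 give the two values of \<open>g1\<close>.\<close>
  moreover have "g1_hat \<tau> = - (of_real pi / 6) * ?L"
  proof -
    define q where "q = exp (2 * of_real pi * \<i> * \<tau>)"
    have gaps: "(2 * of_real (2 * v) * lattice_gap (2 * \<tau>) 1 - of_real v * lattice_gap \<tau> 1) =
            - (of_real pi * (g1 q + g1 (cnj q)))"
      using lattice_gap_combination[OF assms] by (simp add: q_def v_def algebra_simps)
    hence "- (of_real pi / 6) * ?L = - (of_real pi / 6) * (3 * of_real v) + (g1 q + g1 (cnj q)) -
             euler_mascheroni - of_real pi / 12 * B'"
      unfolding gaps by (simp add: B1 zeta2 field_simps power2_eq_square)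
    also have "of_real pi / 12 * B' = - of_real (ln v) / 2 - 2 * of_real (ln 2) - 6 * \<zeta>' / of_real pi ^ 2"
      by (simp add: B'_def field_simps)
    finally show ?thesis
      by (simp add: g1_hat_def Let_def \<zeta>'_def v_def q_def algebra_simps)
  qed
  ultimately show ?thesis by blast
qed

end
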